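(* Let $\mathsf{V}$ be a pseudovariety of semigroups closed under bideterministic product and let $A$ be a finite alphabet. Suppose that $(u,a,v)$ is a good factorization of an element $x$ of $\overline{\Omega}_A\mathsf{V}$. Let $x=wbz$ be a factorization of $x$ with $w,z\in(\overline{\Omega}_A\mathsf{V})^1$ and $b\in A$. Then at least one of the following three cases occurs: (1) $u=w$, $a=b$ and $v=z$; (2) $u=wbt$ and $z=tav$ for some $t\in(\overline{\Omega}_A\mathsf{V})^1$; (3) $w=uat$ and $v=tbz$ for some $t\in(\overline{\Omega}_A\mathsf{V})^1$.
   Context: All alphabets are finite. A semigroup pseudovariety is a class of finite semigroups closed under subsemigroups, homomorphic images and finite direct products. $\overline{\Omega}_A\mathsf{V}$ is the free pro-$\mathsf{V}$ semigroup on $A$, and $(\overline{\Omega}_A\mathsf{V})^1$ is obtained from it by adjoining a neutral element $1$ as an isolated point. Closure under bideterministic product. A language $L\subseteq A^*$ is a prefix code (resp. suffix code) if $uA^+\cap L=\emptyset$ (resp. $A^+u\cap L=\emptyset$) for all $u\in L$. A language $L\subseteq A^+$ is $\mathsf{V}$-recognizable if $L=\varphi^{-1}(\varphi(L))$ for some homomorphism $\varphi\colon A^+\to S$ with $S\in\mathsf{V}$. $\mathsf{V}$ is closed under bideterministic product if, for every alphabet $A$ and letter $a\in A$, $LaK$ is $\mathsf{V}$-recognizable whenever each of $L,K$ is either a $\mathsf{V}$-recognizable subset of $A^+$ or equal to $\{1\}$, $La$ is a prefix code and $aK$ is a suffix code. (Such a $\mathsf{V}$ contains all finite nilpotent semigroups,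 so $A^+$ embeds in $\overline{\Omega}_A\mathsf{V}$ as a set of isolated points.) Good factorizations. For $s,t\in M=(\overline{\Omega}_A\mathsf{V})^1$: $s\le_{\mathcal R}t$ iff $s\in tM$, $s\le_{\mathcal L}t$ iff $s\in Mt$; $s<_{\mathcal K}t$ means $s\le_{\mathcal K}t$ and not $t\le_{\mathcal K}s$. A good factorization of $x\in\overline{\Omega}_A\mathsf{V}$ is a triple $(\pi,a,\rho)\in M\times A\times M$ with $x=\pi a\rho$, $\pi a<_{\mathcal R}\pi$ and $a\rho<_{\mathcal L}\rho$. *)

theory Defs
  imports "HOL-Analysis.Analysis" "HOL-Algebra.Group"
begin

no_notation eq_closure_of (\<open>closure'_of\<index>\<close>)

section \<open>Semigroups\<close>

record 'a semigrp = "'a partial_object" +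
  sg_mult :: "'a \<Rightarrow> 'a \<Rightarrow> 'a"  (infixl "\<cdot>\<index>" 70)

definition is_semigroup :: "('a, 'm) semigrp_scheme \<Rightarrow> bool" where
  "is_semigroup S \<longleftrightarrow>
     carrier S \<noteq> {} \<and>
     (\<forall>x\<in>carrier S. \<forall>y\<in>carrier S. x \<cdot>\<^bsub>S\<^esub> y \<in> carrier S) \<and>
     (\<forall>x\<in>carrier S. \<forall>y\<in>carrier S. \<forall>z\<in>carrier S.
        (x \<cdot>\<^bsub>S\<^esub> y) \<cdot>\<^bsub>S\<^esub> z = x \<cdot>\<^bsub>S\<^esub> (y \<cdot>\<^bsub>S\<^esub> z))"

definition sg_hom :: "('a, 'm) semigrp_scheme \<Rightarrow> ('b, 'n) semigrp_scheme \<Rightarrow> ('a \<Rightarrow> 'b) set" where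
  "sg_hom S T = {h. h \<in> carrier S \<rightarrow> carrier T \<and>
     (\<forall>x\<in>carrier S. \<forall>y\<in>carrier S. h (x \<cdot>\<^bsub>S\<^esub> y) = h x \<cdot>\<^bsub>T\<^esub> h y)}"

definition sg_prod :: "'i set \<Rightarrow> ('i \<Rightarrow> 'a semigrp) \<Rightarrow> ('i \<Rightarrow> 'a) semigrp" where
  "sg_prod I F =
     \<lparr>carrier = (\<Pi>\<^sub>E i\<in>I. carrier (F i)), sg_mult = (\<lambda>x y. \<lambda>i\<in>I. x i \<cdot>\<^bsub>F i\<^esub> y i)\<rparr>"

text \<open>The semigroup \<open>A\<^sup>+\<close> of nonempty words.\<close>

definition free_semigroup :: "'a set \<Rightarrow> 'a list semigrp" where
  "free_semigroup A = \<lparr>carrier = lists A - {[]}, sg_mult = (@)\<rparr>"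

text \<open>The monoid \<open>S\<^sup>1\<close>: a new neutral element is adjoined in all cases, even when \<open>S\<close> already has one.\<close>

definition adjoin_one :: "('a, 'm) semigrp_scheme \<Rightarrow> 'a option monoid" where
  "adjoin_one S =
     \<lparr>carrier = insert None (Some ` carrier S),
      mult = (\<lambda>x y. case x of None \<Rightarrow> y
                 | Some s \<Rightarrow> (case y of None \<Rightarrow> Some s | Some t \<Rightarrow> Some (s \<cdot>\<^bsub>S\<^esub> t))),
      one = None\<rparr>"


section \<open>Pseudovarieties\<close>

text \<open>
  Every finite semigroup is isomorphic to one whose carrier is a set of natural numbers, so a class
  of finite semigroups closed under isomorphism is given by its members with carriers in \<open>nat\<close>.
  A direct product is a semigroup of functions, hence the closure condition for products mentions
  the isomorphic copies of the product carried by sets of natural numbers. The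
  case \<open>n = 0\<close> puts the one-element semigroups into the class.
\<close>

definition pseudovariety :: "nat semigrp set \<Rightarrow> bool" where
  "pseudovariety V \<longleftrightarrow>
     (\<forall>S\<in>V. is_semigroup S \<and> finite (carrier S)) \<and>
     (\<forall>S\<in>V. \<forall>H\<subseteq>carrier S. is_semigroup (S\<lparr>carrier := H\<rparr>) \<longrightarrow> S\<lparr>carrier := H\<rparr> \<in> V) \<and>
     (\<forall>S\<in>V. \<forall>T. is_semigroup T \<and> (\<exists>h\<in>sg_hom S T. h ` carrier S = carrier T) \<longrightarrow> T \<in> V) \<and>
     (\<forall>(n::nat) F T. (\<forall>i<n. F i \<in> V) \<and> is_semigroup T \<and>
        (\<exists>h\<in>sg_hom (sg_prod {..<n} F) T. bij_betw h (carrier (sg_prod {..<n} F)) (carrier T))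
        \<longrightarrow> T \<in> V)"


section \<open>Closure under bideterministic product\<close>

definition prefix_code :: "'a set \<Rightarrow> 'a list set \<Rightarrow> bool" where
  "prefix_code A L \<longleftrightarrow>
     L \<subseteq> lists A \<and> (\<forall>u\<in>L. {u @ w | w. w \<in> carrier (free_semigroup A)} \<inter> L = {})"

definition suffix_code :: "'a set \<Rightarrow> 'a list set \<Rightarrow> bool" where
  "suffix_code A L \<longleftrightarrow>
     L \<subseteq> lists A \<and> (\<forall>u\<in>L. {w @ u | w. w \<in> carrier (free_semigroup A)} \<inter> L = {})"

definition recognizable :: "nat semigrp set \<Rightarrow> 'a set \<Rightarrow> 'a list set \<Rightarrow> bool" where
  "recognizable V A L \<longleftrightarrow>
     L \<subseteq> carrier (free_semigroup A) \<and>
     (\<exists>S\<in>V. \<exists>\<phi>\<in>sg_hom (free_semigroup A) S.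
        L = {w \<in> carrier (free_semigroup A). \<phi> w \<in> \<phi> ` L})"

text \<open>
  The alphabets range over all finite sets of natural numbers. Up to renaming of letters, these are
  all finite alphabets.
\<close>

definition closed_bideterministic :: "nat semigrp set \<Rightarrow> bool" where
  "closed_bideterministic V \<longleftrightarrow>
     (\<forall>A :: nat set. finite A \<longrightarrow> (\<forall>a\<in>A. \<forall>L K.
        (recognizable V A L \<or> L = {[]}) \<and> (recognizable V A K \<or> K = {[]}) \<and>
        prefix_code A {u @ [a] | u. u \<in> L} \<and> suffix_code A {[a] @ v | v. v \<in> K}
        \<longrightarrow> recognizable V A {u @ [a] @ v | u v. u \<in> L \<and> v \<in> K}))"


section \<open>The free pro-\<open>V\<close> semigroup\<close>

text \<open>
  It is the pro-\<open>V\<close> completion of \<open>A\<^sup>+\<close>: the closure of the diagonal image of \<open>A\<^sup>+\<close> in the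
  product, over all homomorphisms from \<open>A\<^sup>+\<close> to members \<open>S\<close> of \<open>V\<close>, of the discrete semigroups
  \<open>S\<close>. The members of \<open>V\<close> having carriers in \<open>nat\<close>, these homomorphisms form a set.
\<close>

type_synonym 'a pro_elt = "nat semigrp \<times> ('a list \<Rightarrow> nat) \<Rightarrow> nat"

definition pro_homs :: "nat semigrp set \<Rightarrow> 'a set \<Rightarrow> (nat semigrp \<times> ('a list \<Rightarrow> nat)) set" where
  "pro_homs V A =
     (SIGMA S:V. sg_hom (free_semigroup A) S \<inter> extensional (carrier (free_semigroup A)))"

definition pro_word :: "nat semigrp set \<Rightarrow> 'a set \<Rightarrow> 'a list \<Rightarrow> 'a pro_elt" where
  "pro_word V A w = (\<lambda>i\<in>pro_homs V A. snd i w)"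

definition pro_product_topology :: "nat semigrp set \<Rightarrow> 'a set \<Rightarrow> 'a pro_elt topology" where
  "pro_product_topology V A =
     product_topology (\<lambda>i. discrete_topology (carrier (fst i))) (pro_homs V A)"

definition free_pro :: "nat semigrp set \<Rightarrow> 'a set \<Rightarrow> 'a pro_elt semigrp" where
  "free_pro V A =
     \<lparr>carrier = pro_product_topology V A closure_of (pro_word V A ` carrier (free_semigroup A)),
      sg_mult = sg_mult (sg_prod (pro_homs V A) fst)\<rparr>"

definition free_pro_topology :: "nat semigrp set \<Rightarrow> 'a set \<Rightarrow> 'a pro_elt topology" where
  "free_pro_topology V A = subtopology (pro_product_topology V A) (carrier (free_pro V A))"

definition free_pro1 :: "nat semigrp set \<Rightarrow> 'a set \<Rightarrow> 'a pro_elt option monoid" where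
  "free_pro1 V A = adjoin_one (free_pro V A)"

definition letter :: "nat semigrp set \<Rightarrow> 'a set \<Rightarrow> 'a \<Rightarrow> 'a pro_elt option" where
  "letter V A a = Some (pro_word V A [a])"


section \<open>Good factorizations\<close>

definition R_le :: "('a, 'm) monoid_scheme \<Rightarrow> 'a \<Rightarrow> 'a \<Rightarrow> bool" where
  "R_le M s t \<longleftrightarrow> (\<exists>m\<in>carrier M. s = t \<otimes>\<^bsub>M\<^esub> m)"

definition L_le :: "('a, 'm) monoid_scheme \<Rightarrow> 'a \<Rightarrow> 'a \<Rightarrow> bool" where
  "L_le M s t \<longleftrightarrow> (\<exists>m\<in>carrier M. s = m \<otimes>\<^bsub>M\<^esub> t)"

definition R_less :: "('a, 'm) monoid_scheme \<Rightarrow> 'a \<Rightarrow> 'a \<Rightarrow> bool" where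
  "R_less M s t \<longleftrightarrow> R_le M s t \<and> \<not> R_le M t s"

definition L_less :: "('a, 'm) monoid_scheme \<Rightarrow> 'a \<Rightarrow> 'a \<Rightarrow> bool" where
  "L_less M s t \<longleftrightarrow> L_le M s t \<and> \<not> L_le M t s"

definition good_factorization ::
  "nat semigrp set \<Rightarrow> 'a set \<Rightarrow> 'a pro_elt \<Rightarrow> 'a pro_elt option \<times> 'a \<times> 'a pro_elt option \<Rightarrow> bool" where
  "good_factorization V A x = (\<lambda>(p, a, r).
     p \<in> carrier (free_pro1 V A) \<and> a \<in> A \<and> r \<in> carrier (free_pro1 V A) \<and>
     Some x = p \<otimes>\<^bsub>free_pro1 V A\<^esub> letter V A a \<otimes>\<^bsub>free_pro1 V A\<^esub> r \<and>
     R_less (free_pro1 V A) (p \<otimes>\<^bsub>free_pro1 V A\<^esub> letter V A a) p \<and>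
     L_less (free_pro1 V A) (letter V A a \<otimes>\<^bsub>free_pro1 V A\<^esub> r) r)"


section \<open>The universal property of the free pro-\<open>V\<close> semigroup\<close>

lemma pseudovarietyD:
  assumes "pseudovariety V" "S \<in> V"
  shows "is_semigroup S" "finite (carrier S)"
  using bspec[OF conjunct1[OF assms(1)[unfolded pseudovariety_def]] assms(2)] by simp_all

lemma pro_homs_semigroup:
  assumes "pseudovariety V" "i \<in> pro_homs V A"
  shows "is_semigroup (fst i)" "finite (carrier (fst i))"
proof -
  have "fst i \<in> V" using assms(2) by (auto simp: pro_homs_def)
  with assms(1) show "is_semigroup (fst i)" "finite (carrier (fst i))" by (rule pseudovarietyD)+
qed

lemma topspace_pro_product:
  "topspace (pro_product_topology V A) = (\<Pi>\<^sub>E i\<in>pro_homs V A. carrier (fst i))"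
  by (simp add: pro_product_topology_def)

lemma pro_word_in_product:
  assumes "w \<in> carrier (free_semigroup A)"
  shows "pro_word V A w \<in> topspace (pro_product_topology V A)"
  using assms by (auto simp: topspace_pro_product pro_word_def pro_homs_def sg_hom_def)

lemma pro_word_in_free_pro:
  assumes "w \<in> carrier (free_semigroup A)"
  shows "pro_word V A w \<in> carrier (free_pro V A)"
  unfolding free_pro_def using assms pro_word_in_product[of _ A V]
  by (auto intro!: subsetD[OF closure_of_subset])

lemma carrier_free_pro_subset: "carrier (free_pro V A) \<subseteq> topspace (pro_product_topology V A)"
  by (simp add: free_pro_def closure_of_subset_topspace)

lemma free_pro_component:
  assumes "x \<in> carrier (free_pro V A)" "i \<in> pro_homs V A"
  shows "x i \<in> carrier (fst i)"
  using assms carrier_free_pro_subset[of V A] unfolding topspace_pro_product by blast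

lemma topspace_free_pro: "topspace (free_pro_topology V A) = carrier (free_pro V A)"
  using carrier_free_pro_subset by (auto simp: free_pro_topology_def)

lemma sg_mult_free_pro:
  "x \<cdot>\<^bsub>free_pro V A\<^esub> y = (\<lambda>i\<in>pro_homs V A. x i \<cdot>\<^bsub>fst i\<^esub> y i)"
  by (simp add: free_pro_def sg_prod_def)

lemma pro_word_append:
  assumes "u \<in> carrier (free_semigroup A)" "v \<in> carrier (free_semigroup A)"
  shows "pro_word V A (u @ v) = pro_word V A u \<cdot>\<^bsub>free_pro V A\<^esub> pro_word V A v"
proof -
  have "snd i (u @ v) = snd i u \<cdot>\<^bsub>fst i\<^esub> snd i v" if "i \<in> pro_homs V A" for i
  proof -
    have "snd i \<in> sg_hom (free_semigroup A) (fst i)"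
      using that by (auto simp: pro_homs_def)
    then have "snd i (u \<cdot>\<^bsub>free_semigroup A\<^esub> v) = snd i u \<cdot>\<^bsub>fst i\<^esub> snd i v"
      using assms unfolding sg_hom_def by blast
    then show ?thesis by (simp add: free_semigroup_def)
  qed
  then show ?thesis
    by (simp add: pro_word_def sg_mult_free_pro cong: restrict_cong)
qed

lemma continuous_map_free_pro_projection:
  assumes "i \<in> pro_homs V A"
  shows "continuous_map (pro_product_topology V A) (discrete_topology (carrier (fst i))) (\<lambda>x. x i)"
  unfolding pro_product_topology_def using assms by (rule continuous_map_product_projection)

lemma continuous_map_pro_mult:
  assumes "pseudovariety V"
  shows "continuous_map
    (prod_topology (pro_product_topology V A) (pro_product_topology V A))
    (pro_product_topology V A) (\<lambda>(x, y). x \<cdot>\<^bsub>free_pro V A\<^esub> y)"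
proof -
  let ?X = "pro_product_topology V A" and ?I = "pro_homs V A"
  have "continuous_map (prod_topology ?X ?X) (discrete_topology (carrier (fst i)))
          (\<lambda>p. fst p i \<cdot>\<^bsub>fst i\<^esub> snd p i)" if i: "i \<in> ?I" for i
  proof -
    let ?D = "discrete_topology (carrier (fst i))"
    have S: "is_semigroup (fst i)"
      using assms i by (rule pro_homs_semigroup)
    have 1: "continuous_map (prod_topology ?X ?X) ?D (\<lambda>p. fst p i)"
      using continuous_map_compose[OF continuous_map_fst continuous_map_free_pro_projection[OF i]]
      by (simp add: comp_def)
    have 2: "continuous_map (prod_topology ?X ?X) ?D (\<lambda>p. snd p i)"
      using continuous_map_compose[OF continuous_map_snd continuous_map_free_pro_projection[OF i]]
      by (simp add: comp_def)
    have 3: "continuous_map (prod_topology ?X ?X) (prod_topology ?D ?D) (\<lambda>p. (fst p i, snd p i))"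
      using 1 2 by (simp add: continuous_map_paired)
    have 4: "continuous_map (prod_topology ?D ?D) ?D (\<lambda>(x, y). x \<cdot>\<^bsub>fst i\<^esub> y)"
      using S by (simp add: is_semigroup_def Pi_iff split_beta flip: prod_topology_discrete_topology)
    show ?thesis
      using continuous_map_compose[OF 3 4] by (simp only: comp_def case_prod_conv)
  qed
  then show ?thesis
    unfolding pro_product_topology_def continuous_map_componentwise sg_mult_free_pro
    by (simp add: split_beta image_subset_iff)
qed

lemma free_pro_mult_closed:
  assumes V: "pseudovariety V" and x: "x \<in> carrier (free_pro V A)" and y: "y \<in> carrier (free_pro V A)"
  shows "x \<cdot>\<^bsub>free_pro V A\<^esub> y \<in> carrier (free_pro V A)"
proof -
  let ?X = "pro_product_topology V A"
  let ?W = "pro_word V A ` carrier (free_semigroup A)"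
  let ?m = "\<lambda>(x, y). x \<cdot>\<^bsub>free_pro V A\<^esub> y"
  have "(x, y) \<in> prod_topology ?X ?X closure_of (?W \<times> ?W)"
    using x y by (simp add: closure_of_Times free_pro_def)
  then have "?m (x, y) \<in> ?X closure_of (?m ` (?W \<times> ?W))"
    using continuous_map_image_closure_subset[OF continuous_map_pro_mult[OF V]] by blast
  moreover have "?m ` (?W \<times> ?W) \<subseteq> ?W"
  proof clarify
    fix u v assume "u \<in> carrier (free_semigroup A)" "v \<in> carrier (free_semigroup A)"
    moreover then have "u @ v \<in> carrier (free_semigroup A)"
      by (auto simp: free_semigroup_def)
    ultimately show "pro_word V A u \<cdot>\<^bsub>free_pro V A\<^esub> pro_word V A v \<in> ?W"
      by (metis pro_word_append imageI)
  qed
  ultimately have "?m (x, y) \<in> ?X closure_of ?W"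
    using closure_of_mono by blast
  then show ?thesis by (simp add: free_pro_def)
qed

lemma free_pro_semigroup:
  assumes V: "pseudovariety V" and "A \<noteq> {}"
  shows "is_semigroup (free_pro V A)"
proof -
  obtain a where "a \<in> A" using \<open>A \<noteq> {}\<close> by blast
  then have "pro_word V A [a] \<in> carrier (free_pro V A)"
    by (intro pro_word_in_free_pro) (simp add: free_semigroup_def)
  moreover have "(x \<cdot>\<^bsub>free_pro V A\<^esub> y) \<cdot>\<^bsub>free_pro V A\<^esub> z = x \<cdot>\<^bsub>free_pro V A\<^esub> (y \<cdot>\<^bsub>free_pro V A\<^esub> z)"
    if "x \<in> carrier (free_pro V A)" "y \<in> carrier (free_pro V A)" "z \<in> carrier (free_pro V A)" for x y z
  proof -
    have "(x i \<cdot>\<^bsub>fst i\<^esub> y i) \<cdot>\<^bsub>fst i\<^esub> z i = x i \<cdot>\<^bsub>fst i\<^esub> (y i \<cdot>\<^bsub>fst i\<^esub> z i)"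
      if i: "i \<in> pro_homs V A" for i
    proof -
      have "is_semigroup (fst i)" using V i by (rule pro_homs_semigroup)
      moreover have "x i \<in> carrier (fst i)" "y i \<in> carrier (fst i)" "z i \<in> carrier (fst i)"
        using free_pro_component[OF _ i] \<open>x \<in> _\<close> \<open>y \<in> _\<close> \<open>z \<in> _\<close> by blast+
      ultimately show ?thesis unfolding is_semigroup_def by blast
    qed
    then show ?thesis
      by (simp add: sg_mult_free_pro cong: restrict_cong)
  qed
  ultimately show ?thesis
    unfolding is_semigroup_def by (intro conjI ballI free_pro_mult_closed[OF V]) auto
qed

lemma compact_free_pro:
  assumes "pseudovariety V"
  shows "compact_space (free_pro_topology V A)"
proof -
  have "compact_space (pro_product_topology V A)"
    unfolding pro_product_topology_def compact_space_product_topology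
    using pro_homs_semigroup(2)[OF assms, of _ A] by (simp add: compact_space_discrete_topology)
  then have "compactin (pro_product_topology V A) (carrier (free_pro V A))"
    by (rule closedin_compact_space) (simp add: free_pro_def)
  then show ?thesis
    by (simp add: free_pro_topology_def compact_space_subtopology)
qed

lemma free_pro_residually:
  assumes "x \<in> carrier (free_pro V A)" "y \<in> carrier (free_pro V A)" "x \<noteq> y"
  shows "\<exists>S\<in>V. \<exists>h\<in>sg_hom (free_pro V A) S.
    continuous_map (free_pro_topology V A) (discrete_topology (carrier S)) h \<and> h x \<noteq> h y"
proof -
  have "x \<in> (\<Pi>\<^sub>E i\<in>pro_homs V A. carrier (fst i))" "y \<in> (\<Pi>\<^sub>E i\<in>pro_homs V A. carrier (fst i))"
    using assms carrier_free_pro_subset[of V A] by (auto simp: topspace_pro_product)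
  then obtain i where i: "i \<in> pro_homs V A" "x i \<noteq> y i"
    using \<open>x \<noteq> y\<close> by (meson PiE_ext)
  moreover have "(\<lambda>x. x i) \<in> sg_hom (free_pro V A) (fst i)"
    using free_pro_component[OF _ i(1)] i(1)
    unfolding sg_hom_def by (simp add: sg_mult_free_pro)
  moreover have "continuous_map (free_pro_topology V A) (discrete_topology (carrier (fst i))) (\<lambda>x. x i)"
    unfolding free_pro_topology_def
    using continuous_map_free_pro_projection[OF i(1)] by (rule continuous_map_from_subtopology)
  moreover have "fst i \<in> V" using i(1) by (auto simp: pro_homs_def)
  ultimately show ?thesis by blast
qed

lemma word_hom_exists:
  assumes S: "is_semigroup S" and f: "f \<in> A \<rightarrow> carrier S"
  obtains \<phi> where "\<phi> \<in> sg_hom (free_semigroup A) S" "\<phi> \<in> extensional (carrier (free_semigroup A))"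
    "\<And>a. a \<in> A \<Longrightarrow> \<phi> [a] = f a"
proof -
  define g where "g w = foldl (\<lambda>s b. s \<cdot>\<^bsub>S\<^esub> f b) (f (hd w)) (tl w)" for w
  have fold_closed: "foldl (\<lambda>s b. s \<cdot>\<^bsub>S\<^esub> f b) s w \<in> carrier S"
    if "s \<in> carrier S" "w \<in> lists A" for s w
    using that S f by (induction w arbitrary: s) (auto simp: is_semigroup_def Pi_iff)
  have fold_mult: "foldl (\<lambda>s b. s \<cdot>\<^bsub>S\<^esub> f b) (s \<cdot>\<^bsub>S\<^esub> t) w = s \<cdot>\<^bsub>S\<^esub> foldl (\<lambda>s b. s \<cdot>\<^bsub>S\<^esub> f b) t w"
    if "s \<in> carrier S" "t \<in> carrier S" "w \<in> lists A" for s t w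
    using that
  proof (induction w arbitrary: t)
    case (Cons b w)
    then have "f b \<in> carrier S" using f by auto
    then have "t \<cdot>\<^bsub>S\<^esub> f b \<in> carrier S" "(s \<cdot>\<^bsub>S\<^esub> t) \<cdot>\<^bsub>S\<^esub> f b = s \<cdot>\<^bsub>S\<^esub> (t \<cdot>\<^bsub>S\<^esub> f b)"
      using Cons.prems S by (auto simp: is_semigroup_def)
    then show ?case using Cons by auto
  qed simp
  have g_closed: "g w \<in> carrier S" if "w \<in> lists A - {[]}" for w
    using that fold_closed f by (cases w) (auto simp: g_def)
  have g_append: "g (u @ v) = g u \<cdot>\<^bsub>S\<^esub> g v" if "u \<in> lists A - {[]}" "v \<in> lists A - {[]}" for u v
  proof -
    obtain b v' where v: "v = b # v'" "b \<in> A" "v' \<in> lists A"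
      using \<open>v \<in> _\<close> by (cases v) auto
    have "g (u @ v) = foldl (\<lambda>s b. s \<cdot>\<^bsub>S\<^esub> f b) (g u) v"
      using \<open>u \<in> _\<close> by (auto simp: g_def)
    also have "\<dots> = g u \<cdot>\<^bsub>S\<^esub> g v"
      using v f fold_mult[OF g_closed[OF \<open>u \<in> _\<close>], of "f b" v'] by (auto simp: g_def)
    finally show ?thesis .
  qed
  let ?\<phi> = "restrict g (carrier (free_semigroup A))"
  have "?\<phi> \<in> sg_hom (free_semigroup A) S"
    using g_closed g_append by (auto simp: sg_hom_def free_semigroup_def)
  moreover have "?\<phi> [a] = f a" if "a \<in> A" for a
    using that by (simp add: free_semigroup_def g_def)
  ultimately show ?thesis using that by blast
qed

lemma sg_hom_words_eqI:
  assumes "h \<in> sg_hom (free_pro V A) S" "k \<in> sg_hom (free_pro V A) S"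
    and "\<And>a. a \<in> A \<Longrightarrow> h (pro_word V A [a]) = k (pro_word V A [a])"
    and "w \<in> carrier (free_semigroup A)"
  shows "h (pro_word V A w) = k (pro_word V A w)"
proof -
  have "w \<noteq> []" "w \<in> lists A" using assms(4) by (auto simp: free_semigroup_def)
  then show ?thesis
  proof (induction w rule: list_nonempty_induct)
    case (single a)
    then show ?case using assms(3) by simp
  next
    case (cons a w)
    have a: "[a] \<in> carrier (free_semigroup A)" and w: "w \<in> carrier (free_semigroup A)"
      using cons by (auto simp: free_semigroup_def)
    have "pro_word V A (a # w) = pro_word V A [a] \<cdot>\<^bsub>free_pro V A\<^esub> pro_word V A w"
      using pro_word_append[OF a w] by simp
    moreover have "h (pro_word V A w) = k (pro_word V A w)" using cons by simp
    ultimately show ?case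
      using assms(1-3) cons.prems pro_word_in_free_pro[OF a] pro_word_in_free_pro[OF w]
      by (auto simp: sg_hom_def)
  qed
qed

proposition free_pro_universal:
  assumes V: "pseudovariety V" and S: "S \<in> V" and f: "f \<in> A \<rightarrow> carrier S"
  shows "\<exists>h. (h \<in> sg_hom (free_pro V A) S \<and>
      continuous_map (free_pro_topology V A) (discrete_topology (carrier S)) h \<and>
      (\<forall>a\<in>A. h (pro_word V A [a]) = f a)) \<and>
    (\<forall>k. k \<in> sg_hom (free_pro V A) S \<and>
      continuous_map (free_pro_topology V A) (discrete_topology (carrier S)) k \<and>
      (\<forall>a\<in>A. k (pro_word V A [a]) = f a) \<longrightarrow> (\<forall>x\<in>carrier (free_pro V A). k x = h x))"
proof -
  have "is_semigroup S" using V S by (rule pseudovarietyD)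
  then obtain \<phi> where \<phi>: "\<phi> \<in> sg_hom (free_semigroup A) S"
      "\<phi> \<in> extensional (carrier (free_semigroup A))" "\<And>a. a \<in> A \<Longrightarrow> \<phi> [a] = f a"
    using word_hom_exists[OF _ f] by metis
  let ?i = "(S, \<phi>)" and ?h = "\<lambda>x :: 'a pro_elt. x (S, \<phi>)"
  have i: "?i \<in> pro_homs V A" using \<phi> S by (simp add: pro_homs_def)
  have hom: "?h \<in> sg_hom (free_pro V A) S"
    using free_pro_component[OF _ i] i
    unfolding sg_hom_def by (simp add: sg_mult_free_pro)
  have cont: "continuous_map (free_pro_topology V A) (discrete_topology (carrier S)) ?h"
    unfolding free_pro_topology_def
    using continuous_map_free_pro_projection[OF i] by (auto intro: continuous_map_from_subtopology)
  have val: "\<forall>a\<in>A. ?h (pro_word V A [a]) = f a"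
    using i \<phi>(3) by (simp add: pro_word_def)
  have uniq: "k x = ?h x" if k: "k \<in> sg_hom (free_pro V A) S"
      "continuous_map (free_pro_topology V A) (discrete_topology (carrier S)) k"
      "\<forall>a\<in>A. k (pro_word V A [a]) = f a" and x: "x \<in> carrier (free_pro V A)" for k x
  proof (rule forall_in_closure_of_eq[OF _ _ k(2) cont])
    let ?W = "pro_word V A ` carrier (free_semigroup A)"
    have "?W \<subseteq> carrier (free_pro V A)" using pro_word_in_free_pro[of _ A V] by auto
    then have "free_pro_topology V A closure_of ?W = carrier (free_pro V A)"
      by (simp add: free_pro_topology_def closure_of_subtopology Int_absorb1) (simp add: free_pro_def)
    then show "x \<in> free_pro_topology V A closure_of ?W" using x by simp
    show "Hausdorff_space (discrete_topology (carrier S))" by simp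
    show "k y = ?h y" if "y \<in> ?W" for y
      using that sg_hom_words_eqI[OF k(1) hom] k(3) val by auto
  qed
  show ?thesis using hom cont val uniq by (intro exI[of _ ?h]) blast
qed

lemma free_pro1_monoid:
  assumes "pseudovariety V" "A \<noteq> {}"
  shows "monoid (free_pro1 V A)"
  using free_pro_semigroup[OF assms]
  by unfold_locales (auto simp: free_pro1_def adjoin_one_def is_semigroup_def)

end

theory Submission
  imports Defs
begin

text \<open>
  Write \<open>M\<close> for the monoid obtained from the free pro-\<open>V\<close> semigroup by adjoining an isolated neutral
  element. It is a compact Hausdorff topological monoid in which the words of \<open>A\<^sup>*\<close> are dense. Call
  two pairs \<open>(u, v)\<close> and \<open>(w, z)\<close> comparable if one of the three alternatives of the theorem
  holds. For words, \<open>u a v = w b z\<close> forces comparability, because free monoids are equidivisible.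
  Moreover, comparability is a closed relation, each alternative being parametrized continuously by
  a power of the compact space \<open>M\<close> (lemma \<open>closedin_comparable_factorizations\<close>). Hence it suffices
  to find words \<open>l, k, w', z'\<close> arbitrarily close to \<open>u, v, w, z\<close> with \<open>l a k = w' b z'\<close>.

  Words \<open>w'\<close> and \<open>z'\<close> close to \<open>w\<close> and \<open>z\<close> give a product \<open>w' b z'\<close> close to \<open>x = u a v\<close>, so what has
  to be shown is that every word close enough to \<open>x\<close> is of the form \<open>l a k\<close> with \<open>l\<close> close to \<open>u\<close> and
  \<open>k\<close> close to \<open>v\<close>. This openness of the multiplication at \<open>(u, v)\<close> is what the hypotheses on \<open>V\<close> and
  on the factorization provide (lemma \<open>marked_product_neighbourhood\<close>). Since \<open>u a <\<^sub>R u\<close>, the element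
  \<open>u\<close> is outside the closed set \<open>u a M\<close>, and by compactness a whole neighbourhood \<open>N\<close> of \<open>u\<close> is
  disjoint from \<open>N a M\<close>. It can be shrunk until the words in it form a recognizable language \<open>L\<close> or the
  language \<open>L = {1}\<close>, and \<open>N \<inter> N a M = {}\<close> says in particular that \<open>L a\<close> is a prefix code. Dually, the
  words in a small neighbourhood of \<open>v\<close> form a language \<open>K\<close> such that \<open>a K\<close> is a suffix code. Closure
  under bideterministic product makes \<open>L a K\<close> recognizable, so a clopen set containing \<open>x\<close> has
  exactly the words of \<open>L a K\<close> in it.
\<close>

section \<open>Recognizable languages\<close>

lemma recognizableI:
  assumes "S \<in> V" "\<phi> \<in> sg_hom (free_semigroup A) S" "L \<subseteq> carrier (free_semigroup A)"
    and "\<And>w w'. w \<in> L \<Longrightarrow> w' \<in> carrier (free_semigroup A) \<Longrightarrow> \<phi> w = \<phi> w' \<Longrightarrow> w' \<in> L"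
  shows "recognizable V A L"
  unfolding recognizable_def
proof (intro conjI bexI)
  show "L = {w \<in> carrier (free_semigroup A). \<phi> w \<in> \<phi> ` L}"
    using assms(3,4) by (auto; metis)
qed (use assms in auto)

lemma recognizable_inverse_renaming:
  assumes L: "recognizable V B L" and f: "f \<in> A \<rightarrow> B"
  shows "recognizable V A {w \<in> carrier (free_semigroup A). map f w \<in> L}"
proof -
  obtain S \<phi> where S: "S \<in> V" "\<phi> \<in> sg_hom (free_semigroup B) S"
      "L = {w \<in> carrier (free_semigroup B). \<phi> w \<in> \<phi> ` L}"
    using L unfolding recognizable_def by blast
  have map_closed: "map f w \<in> carrier (free_semigroup B)" if "w \<in> carrier (free_semigroup A)" for w
    using that f by (fastforce simp: free_semigroup_def)
  show ?thesis
  proof (rule recognizableI[OF S(1), where \<phi> = "\<phi> \<circ> map f"])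
    show "\<phi> \<circ> map f \<in> sg_hom (free_semigroup A) S"
      using S(2) map_closed by (auto simp: sg_hom_def free_semigroup_def Pi_iff)
    fix w w' assume w: "w \<in> {w \<in> carrier (free_semigroup A). map f w \<in> L}"
      and w': "w' \<in> carrier (free_semigroup A)" and eq: "(\<phi> \<circ> map f) w = (\<phi> \<circ> map f) w'"
    have "\<phi> (map f w') \<in> \<phi> ` L" using w eq by (metis (mono_tags, lifting) comp_apply imageI mem_Collect_eq)
    then have "map f w' \<in> L" using S(3) map_closed[OF w'] by blast
    then show "w' \<in> {w \<in> carrier (free_semigroup A). map f w \<in> L}" using w' by simp
  qed auto
qed

text \<open>
  An injective renaming turns the direct image of a language into its inverse image under the inverse
  renaming.
\<close>

lemma recognizable_renaming:
  assumes L: "recognizable V A L" and f: "inj_on f A"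
  shows "recognizable V (f ` A) (map f ` L)"
proof -
  let ?g = "inv_into A f"
  have LA: "L \<subseteq> lists A - {[]}" using L by (simp add: recognizable_def free_semigroup_def)
  have gf: "map ?g (map f w) = w" if "w \<in> lists A" for w
    using that f by (induction w) auto
  have fg: "map f (map ?g w) = w" if "w \<in> lists (f ` A)" for w
    using that by (induction w) (auto simp: f_inv_into_f)
  have "map f ` L = {w \<in> carrier (free_semigroup (f ` A)). map ?g w \<in> L}"
  proof (intro subset_antisym subsetI)
    fix w assume "w \<in> map f ` L"
    then obtain v where v: "v \<in> L" "w = map f v" by blast
    then have "v \<in> lists A - {[]}" using LA by blast
    then show "w \<in> {w \<in> carrier (free_semigroup (f ` A)). map ?g w \<in> L}"
      using v gf[of v] by (auto simp: free_semigroup_def simp del: map_map)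
  next
    fix w assume "w \<in> {w \<in> carrier (free_semigroup (f ` A)). map ?g w \<in> L}"
    then show "w \<in> map f ` L" using fg[of w] by (auto simp: free_semigroup_def simp del: map_map intro!: image_eqI)
  qed
  then show ?thesis
    using recognizable_inverse_renaming[OF L, of ?g "f ` A"] by (auto simp: inv_into_into)
qed

lemma recognizable_subset_lists: "recognizable V A L \<or> L = {[]} \<Longrightarrow> L \<subseteq> lists A"
  unfolding recognizable_def free_semigroup_def by auto

text \<open>
  A word of \<open>L a\<close> that properly extends \<open>u a\<close> again ends in \<open>a\<close>, so it is \<open>u a s a\<close> with \<open>u a s\<close> in \<open>L\<close>.
  In this form the condition is inherited from a neighbourhood \<open>N\<close> with \<open>N \<inter> N a M = {}\<close>.
\<close>

lemma prefix_code_marked_iff: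
  assumes "L \<subseteq> lists A" "a \<in> A"
  shows "prefix_code A {u @ [a] | u. u \<in> L} \<longleftrightarrow> (\<forall>u\<in>L. \<forall>s\<in>lists A. u @ [a] @ s \<notin> L)"
proof
  assume pre: "prefix_code A {u @ [a] | u. u \<in> L}"
  show "\<forall>u\<in>L. \<forall>s\<in>lists A. u @ [a] @ s \<notin> L"
  proof (intro ballI notI)
    fix u s assume *: "u \<in> L" "s \<in> lists A" "u @ [a] @ s \<in> L"
    have "(u @ [a]) @ (s @ [a]) \<in> {(u @ [a]) @ w | w. w \<in> carrier (free_semigroup A)}"
      using * \<open>a \<in> A\<close> by (auto simp: free_semigroup_def)
    moreover have "(u @ [a]) @ (s @ [a]) \<in> {u @ [a] | u. u \<in> L}"
      using * by (intro CollectI exI[of _ "u @ [a] @ s"]) simp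
    moreover have "u @ [a] \<in> {u @ [a] | u. u \<in> L}" using * by blast
    ultimately show False using pre unfolding prefix_code_def by blast
  qed
next
  assume R: "\<forall>u\<in>L. \<forall>s\<in>lists A. u @ [a] @ s \<notin> L"
  have False if *: "u \<in> L" "u' \<in> L" "w \<in> lists A" "w \<noteq> []" "(u @ [a]) @ w = u' @ [a]" for u u' w
  proof -
    obtain s where "w = s @ [a]" "u' = u @ [a] @ s"
      using *(4,5) by (cases w rule: rev_cases) auto
    then show False using R * by auto
  qed
  moreover have "{u @ [a] | u. u \<in> L} \<subseteq> lists A" using assms by fastforce
  ultimately show "prefix_code A {u @ [a] | u. u \<in> L}"
    unfolding prefix_code_def free_semigroup_def by fastforce
qed

lemma suffix_code_marked_iff:
  assumes "L \<subseteq> lists A" "a \<in> A"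
  shows "suffix_code A {[a] @ v | v. v \<in> L} \<longleftrightarrow> (\<forall>v\<in>L. \<forall>s\<in>lists A. s @ [a] @ v \<notin> L)"
proof
  assume suf: "suffix_code A {[a] @ v | v. v \<in> L}"
  show "\<forall>v\<in>L. \<forall>s\<in>lists A. s @ [a] @ v \<notin> L"
  proof (intro ballI notI)
    fix v s assume *: "v \<in> L" "s \<in> lists A" "s @ [a] @ v \<in> L"
    have "([a] @ s) @ ([a] @ v) \<in> {w @ ([a] @ v) | w. w \<in> carrier (free_semigroup A)}"
      using * \<open>a \<in> A\<close> by (intro CollectI exI[of _ "[a] @ s"]) (simp add: free_semigroup_def)
    moreover have "([a] @ s) @ ([a] @ v) \<in> {[a] @ v | v. v \<in> L}"
      using * by (intro CollectI exI[of _ "s @ [a] @ v"]) simp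
    moreover have "[a] @ v \<in> {[a] @ v | v. v \<in> L}" using * by blast
    ultimately show False using suf unfolding suffix_code_def by blast
  qed
next
  assume R: "\<forall>v\<in>L. \<forall>s\<in>lists A. s @ [a] @ v \<notin> L"
  have False if *: "v \<in> L" "v' \<in> L" "w \<in> lists A" "w \<noteq> []" "w @ ([a] @ v) = [a] @ v'" for v v' w
  proof -
    obtain s where "w = [a] @ s" "v' = s @ [a] @ v"
      using *(4,5) by (cases w) auto
    then show False using R * by auto
  qed
  moreover have "{[a] @ v | v. v \<in> L} \<subseteq> lists A" using assms by fastforce
  ultimately show "suffix_code A {[a] @ v | v. v \<in> L}"
    unfolding suffix_code_def free_semigroup_def by fastforce
qed

text \<open>
  The closure condition is about alphabets of natural numbers. An injection of the letters into the
  natural numbers carries both the languages and the two code conditions over.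
\<close>

lemma closed_bideterministic_alphabet:
  assumes V: "closed_bideterministic V" and "finite A" "a \<in> A"
    and L: "recognizable V A L \<or> L = {[]}" and K: "recognizable V A K \<or> K = {[]}"
    and pre: "prefix_code A {u @ [a] | u. u \<in> L}" and suf: "suffix_code A {[a] @ v | v. v \<in> K}"
  shows "recognizable V A {u @ [a] @ v | u v. u \<in> L \<and> v \<in> K}"
proof -
  obtain f :: "'a \<Rightarrow> nat" where f: "inj_on f A"
    using \<open>finite A\<close> by (metis finite_imp_inj_to_nat_seg)
  let ?B = "f ` A"
  note LA = recognizable_subset_lists[OF L] and KA = recognizable_subset_lists[OF K]
  have inj: "inj_on (map f) (lists A)"
    using f by (rule inj_on_map_lists)
  have map_mem: "map f w \<in> map f ` N \<longleftrightarrow> w \<in> N" if "w \<in> lists A" "N \<subseteq> lists A" for w N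
    using inj_on_image_mem_iff[OF inj that] .
  have fLB: "map f ` L \<subseteq> lists ?B" and fKB: "map f ` K \<subseteq> lists ?B"
    using LA KA unfolding lists_image by blast+
  have fa: "f a \<in> ?B" using \<open>a \<in> A\<close> by simp
  have "recognizable V ?B (map f ` L) \<or> map f ` L = {[]}"
    using L recognizable_renaming[OF _ f] by auto
  moreover have "recognizable V ?B (map f ` K) \<or> map f ` K = {[]}"
    using K recognizable_renaming[OF _ f] by auto
  moreover have "prefix_code ?B {u @ [f a] | u. u \<in> map f ` L}"
    unfolding prefix_code_marked_iff[OF fLB fa] lists_image
  proof (intro ballI notI)
    fix u' s' assume "u' \<in> map f ` L" "s' \<in> map f ` lists A" "u' @ [f a] @ s' \<in> map f ` L"
    then obtain u s where *: "u \<in> L" "s \<in> lists A" "map f u @ [f a] @ map f s \<in> map f ` L"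
      by blast
    then have "map f (u @ [a] @ s) \<in> map f ` L" by simp
    then have "u @ [a] @ s \<in> L"
      using map_mem[of "u @ [a] @ s" L] * LA \<open>a \<in> A\<close> by auto
    then show False using pre * unfolding prefix_code_marked_iff[OF LA \<open>a \<in> A\<close>] by blast
  qed
  moreover have "suffix_code ?B {[f a] @ v | v. v \<in> map f ` K}"
    unfolding suffix_code_marked_iff[OF fKB fa] lists_image
  proof (intro ballI notI)
    fix v' s' assume "v' \<in> map f ` K" "s' \<in> map f ` lists A" "s' @ [f a] @ v' \<in> map f ` K"
    then obtain v s where *: "v \<in> K" "s \<in> lists A" "map f s @ [f a] @ map f v \<in> map f ` K"
      by blast
    then have "map f (s @ [a] @ v) \<in> map f ` K" by simp
    then have "s @ [a] @ v \<in> K"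
      using map_mem[of "s @ [a] @ v" K] * KA \<open>a \<in> A\<close> by auto
    then show False using suf * unfolding suffix_code_marked_iff[OF KA \<open>a \<in> A\<close>] by blast
  qed
  ultimately have rec: "recognizable V ?B {u @ [f a] @ v | u v. u \<in> map f ` L \<and> v \<in> map f ` K}"
    using V[unfolded closed_bideterministic_def, rule_format, OF finite_imageI[OF \<open>finite A\<close>] fa,
        of "map f ` L" "map f ` K"] by argo
  have "{u @ [f a] @ v | u v. u \<in> map f ` L \<and> v \<in> map f ` K}
      = map f ` {u @ [a] @ v | u v. u \<in> L \<and> v \<in> K}" (is "_ = _ ` ?LaK")
  proof (intro subset_antisym subsetI)
    fix w assume "w \<in> {u @ [f a] @ v | u v. u \<in> map f ` L \<and> v \<in> map f ` K}"
    then obtain u v where "u \<in> L" "v \<in> K" "w = map f (u @ [a] @ v)" by auto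
    then show "w \<in> map f ` ?LaK" by blast
  next
    fix w assume "w \<in> map f ` ?LaK"
    then obtain u v where "u \<in> L" "v \<in> K" "w = map f u @ [f a] @ map f v" by auto
    then show "w \<in> {u @ [f a] @ v | u v. u \<in> map f ` L \<and> v \<in> map f ` K}" by blast
  qed
  moreover have LaK: "?LaK \<subseteq> lists A" "[] \<notin> ?LaK"
    using LA KA \<open>a \<in> A\<close> by fastforce+
  moreover have "{w \<in> carrier (free_semigroup A). map f w \<in> map f ` ?LaK} = ?LaK"
  proof (intro subset_antisym subsetI)
    fix w assume "w \<in> {w \<in> carrier (free_semigroup A). map f w \<in> map f ` ?LaK}"
    then show "w \<in> ?LaK" using map_mem[OF _ LaK(1), of w] unfolding free_semigroup_def by simp
  next
    fix w assume w: "w \<in> ?LaK"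
    then have "w \<in> lists A" "w \<noteq> []" using LaK by blast+
    then show "w \<in> {w \<in> carrier (free_semigroup A). map f w \<in> map f ` ?LaK}"
      using w unfolding free_semigroup_def by simp
  qed
  ultimately show ?thesis
    using recognizable_inverse_renaming[OF rec, of f A] by simp
qed

text \<open>
  The product is a semigroup of functions, hence only an isomorphic copy of it can be a member of \<open>V\<close>.
  The product being finite, its elements can be coded by natural numbers.
\<close>

lemma pseudovariety_finite_product:
  fixes n :: nat
  assumes V: "pseudovariety V" and G: "\<And>i. i < n \<Longrightarrow> G i \<in> V"
  obtains T h where "T \<in> V" "h \<in> sg_hom (sg_prod {..<n} G) T" "inj_on h (carrier (sg_prod {..<n} G))"
proof -
  let ?P = "sg_prod {..<n} G"
  have semi: "is_semigroup (G i)" "finite (carrier (G i))" if "i < n" for i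
    using pseudovarietyD[OF V G[OF that]] by auto
  have "finite (carrier ?P)"
    using semi by (auto simp: sg_prod_def intro!: finite_PiE)
  then obtain e :: "(nat \<Rightarrow> nat) \<Rightarrow> nat" where e: "inj_on e (carrier ?P)"
    by (metis finite_imp_inj_to_nat_seg)
  let ?d = "inv_into (carrier ?P) e"
  let ?T = "\<lparr>carrier = e ` carrier ?P, sg_mult = \<lambda>x y. e (?d x \<cdot>\<^bsub>?P\<^esub> ?d y)\<rparr>"
  have P: "is_semigroup ?P"
  proof -
    have "carrier ?P \<noteq> {}"
      using semi by (auto simp: sg_prod_def PiE_eq_empty_iff is_semigroup_def)
    moreover have "x \<cdot>\<^bsub>?P\<^esub> y \<in> carrier ?P" if "x \<in> carrier ?P" "y \<in> carrier ?P" for x y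
      using that semi by (auto simp: sg_prod_def is_semigroup_def PiE_iff)
    moreover have "(x \<cdot>\<^bsub>?P\<^esub> y) \<cdot>\<^bsub>?P\<^esub> z = x \<cdot>\<^bsub>?P\<^esub> (y \<cdot>\<^bsub>?P\<^esub> z)"
      if "x \<in> carrier ?P" "y \<in> carrier ?P" "z \<in> carrier ?P" for x y z
      using that semi by (auto simp: sg_prod_def is_semigroup_def PiE_iff intro!: restrict_ext)
    ultimately show ?thesis unfolding is_semigroup_def by blast
  qed
  have de: "?d (e x) = x" if "x \<in> carrier ?P" for x
    using e that by simp
  have T: "is_semigroup ?T"
    using P de by (auto simp: is_semigroup_def)
  have h: "e \<in> sg_hom ?P ?T"
    using de by (auto simp: sg_hom_def)
  have bij: "bij_betw e (carrier ?P) (carrier ?T)"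
    using e by (simp add: bij_betw_def)
  have "?T \<in> V"
    using V G T h bij unfolding pseudovariety_def by blast
  then show ?thesis using that h e by blast
qed

text \<open>
  The finitely many coordinates together form one homomorphism into a finite product.
\<close>

lemma recognizable_pro_homs_cylinder:
  assumes V: "pseudovariety V" and F: "finite F" "F \<subseteq> pro_homs V A"
  shows "recognizable V A {w \<in> carrier (free_semigroup A). \<forall>i\<in>F. snd i w = y i}"
proof -
  obtain n :: nat and k where k: "bij_betw k {..<n} F"
    using ex_bij_betw_nat_finite[OF F(1)] by (auto simp: atLeast0LessThan)
  have kI: "k j \<in> pro_homs V A" if "j < n" for j
    using k F that by (auto simp: bij_betw_def)
  then have "\<And>j. j < n \<Longrightarrow> (fst \<circ> k) j \<in> V"
    by (fastforce simp: pro_homs_def)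
  then obtain T h where T: "T \<in> V" "h \<in> sg_hom (sg_prod {..<n} (fst \<circ> k)) T"
      "inj_on h (carrier (sg_prod {..<n} (fst \<circ> k)))"
    by (rule pseudovariety_finite_product[OF V])
  let ?\<psi> = "\<lambda>w. \<lambda>j\<in>{..<n}. snd (k j) w"
  have hom: "snd (k j) \<in> sg_hom (free_semigroup A) (fst (k j))" if "j < n" for j
    using kI[OF that] by (auto simp: pro_homs_def)
  have \<psi>: "?\<psi> \<in> sg_hom (free_semigroup A) (sg_prod {..<n} (fst \<circ> k))"
    using hom by (auto simp: sg_hom_def sg_prod_def Pi_iff intro!: restrict_ext)
  show ?thesis
  proof (rule recognizableI[OF T(1), where \<phi> = "h \<circ> ?\<psi>"])
    show "h \<circ> ?\<psi> \<in> sg_hom (free_semigroup A) T"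
      using \<psi> T(2) unfolding sg_hom_def by (auto simp: Pi_iff)
    fix w w' assume w: "w \<in> {w \<in> carrier (free_semigroup A). \<forall>i\<in>F. snd i w = y i}"
      and w': "w' \<in> carrier (free_semigroup A)" and eq: "(h \<circ> ?\<psi>) w = (h \<circ> ?\<psi>) w'"
    have \<psi>_eq: "?\<psi> w = ?\<psi> w'"
    proof (rule inj_onD[OF T(3)])
      show "h (?\<psi> w) = h (?\<psi> w')" using eq by simp
    qed (use \<psi> w w' in \<open>auto simp: sg_hom_def Pi_iff\<close>)
    have "snd (k j) w = snd (k j) w'" if "j < n" for j
      using fun_cong[OF \<psi>_eq, of j] that by simp
    then have "snd i w = snd i w'" if "i \<in> F" for i
      using that k by (auto simp: bij_betw_def)
    then show "w' \<in> {w \<in> carrier (free_semigroup A). \<forall>i\<in>F. snd i w = y i}"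
      using w w' by auto
  qed auto
qed

section \<open>Adjoining an isolated point to a topological space\<close>

definition adjoin_point_topology :: "'a topology \<Rightarrow> 'a option topology" where
  "adjoin_point_topology X =
     topology (\<lambda>U. U \<subseteq> insert None (Some ` topspace X) \<and> openin X (Some -` U))"

lemma openin_adjoin_point:
  "openin (adjoin_point_topology X) U \<longleftrightarrow>
     U \<subseteq> insert None (Some ` topspace X) \<and> openin X (Some -` U)"
proof -
  have "istopology (\<lambda>U. U \<subseteq> insert None (Some ` topspace X) \<and> openin X (Some -` U))"
    unfolding istopology_def vimage_Union by (auto simp: vimage_Int)
  then show ?thesis by (simp add: adjoin_point_topology_def)
qed

lemma openin_adjoin_point_None: "openin (adjoin_point_topology X) {None}"
proof -
  have "Some -` {None} = {}" by auto
  then have "openin X (Some -` {None})" by (metis openin_empty)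
  then show ?thesis by (simp add: openin_adjoin_point)
qed

lemma openin_adjoin_point_Some: "openin X U \<Longrightarrow> openin (adjoin_point_topology X) (Some ` U)"
  using openin_subset[of X U] by (auto simp: openin_adjoin_point inj_vimage_image_eq)

lemma topspace_adjoin_point: "topspace (adjoin_point_topology X) = insert None (Some ` topspace X)"
proof (rule subset_antisym)
  show "topspace (adjoin_point_topology X) \<subseteq> insert None (Some ` topspace X)"
    using openin_topspace[of "adjoin_point_topology X"] unfolding openin_adjoin_point by blast
  show "insert None (Some ` topspace X) \<subseteq> topspace (adjoin_point_topology X)"
    using openin_subset[OF openin_adjoin_point_None, of X]
      openin_subset[OF openin_adjoin_point_Some[OF openin_topspace], of X] by simp
qed

lemma compact_space_adjoin_point:
  assumes "compact_space X"
  shows "compact_space (adjoin_point_topology X)"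
proof -
  have "continuous_map X (adjoin_point_topology X) Some"
    unfolding continuous_map
  proof (intro conjI allI impI)
    fix U assume "openin (adjoin_point_topology X) U"
    then have U: "openin X (Some -` U)" by (simp add: openin_adjoin_point)
    then have "{x \<in> topspace X. Some x \<in> U} = Some -` U" using openin_subset[OF U] by blast
    then show "openin X {x \<in> topspace X. Some x \<in> U}" using U by simp
  qed (auto simp: topspace_adjoin_point)
  then have "compactin (adjoin_point_topology X) (Some ` topspace X)"
    using assms unfolding compact_space_def by (intro image_compactin)
  moreover have "compactin (adjoin_point_topology X) {None}"
    by (simp add: topspace_adjoin_point)
  ultimately show ?thesis
    unfolding compact_space_def topspace_adjoin_point by (metis compactin_Un insert_is_Un)
qed

lemma Hausdorff_space_adjoin_point:
  assumes "Hausdorff_space X"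
  shows "Hausdorff_space (adjoin_point_topology X)"
  unfolding Hausdorff_space_def
proof (intro allI impI, elim conjE)
  let ?Y = "adjoin_point_topology X"
  fix p q assume pq: "p \<in> topspace ?Y" "q \<in> topspace ?Y" "p \<noteq> q"
  have top: "openin ?Y (Some ` topspace X)" by (simp add: openin_adjoin_point_Some)
  show "\<exists>U W. openin ?Y U \<and> openin ?Y W \<and> p \<in> U \<and> q \<in> W \<and> disjnt U W"
  proof (cases "p = None \<or> q = None")
    case True
    then show ?thesis
    proof
      assume "p = None"
      then show ?thesis using pq top openin_adjoin_point_None
        by (intro exI[of _ "{None}"] exI[of _ "Some ` topspace X"])
          (auto simp: topspace_adjoin_point disjnt_def)
    next
      assume "q = None"
      then show ?thesis using pq top openin_adjoin_point_None
        by (intro exI[of _ "{None}"] exI[of _ "Some ` topspace X"])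
          (auto simp: topspace_adjoin_point disjnt_def)
    qed
  next
    case False
    then obtain x y where xy: "p = Some x" "q = Some y" "x \<in> topspace X" "y \<in> topspace X" "x \<noteq> y"
      using pq by (auto simp: topspace_adjoin_point)
    then obtain U W where "openin X U" "openin X W" "x \<in> U" "y \<in> W" "disjnt U W"
      using assms[unfolded Hausdorff_space_def, rule_format, of x y] by blast
    then show ?thesis
      using xy by (intro exI[of _ "Some ` U"] exI[of _ "Some ` W"])
        (auto simp: disjnt_def openin_adjoin_point_Some)
  qed
qed

text \<open>
  The new element is isolated and neutral, so wherever a factor is \<open>None\<close> the multiplication is
  locally the identity in the other factor; elsewhere it is locally the multiplication of \<open>S\<close>.
\<close>

lemma continuous_map_adjoin_one_mult:
  assumes X: "topspace X = carrier S"
    and cont: "continuous_map (prod_topology X X) X (\<lambda>(x, y). x \<cdot>\<^bsub>S\<^esub> y)"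
  shows "continuous_map (prod_topology (adjoin_point_topology X) (adjoin_point_topology X))
    (adjoin_point_topology X) (\<lambda>(p, q). p \<otimes>\<^bsub>adjoin_one S\<^esub> q)"
  (is "continuous_map (prod_topology ?Y ?Y) ?Y ?m")
proof -
  have closed: "x \<cdot>\<^bsub>S\<^esub> y \<in> carrier S" if "x \<in> carrier S" "y \<in> carrier S" for x y
    using continuous_map_image_subset_topspace[OF cont] that X by auto
  have "openin (prod_topology ?Y ?Y) {r \<in> topspace (prod_topology ?Y ?Y). ?m r \<in> W}"
    if W: "openin ?Y W" for W
    unfolding openin_prod_topology_alt
  proof (intro allI impI)
    fix p q assume pq: "(p, q) \<in> {r \<in> topspace (prod_topology ?Y ?Y). ?m r \<in> W}"
    have WX: "openin X (Some -` W)" "W \<subseteq> topspace ?Y"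
      using W by (auto simp: openin_adjoin_point topspace_adjoin_point)
    have unit: "None \<otimes>\<^bsub>adjoin_one S\<^esub> r = r" "r \<otimes>\<^bsub>adjoin_one S\<^esub> None = r" for r
      by (auto simp: adjoin_one_def split: option.splits)
    have None: "openin ?Y {None}" "None \<in> topspace ?Y"
      by (simp_all add: openin_adjoin_point_None topspace_adjoin_point)
    have mem: "p \<in> topspace ?Y" "q \<in> topspace ?Y" "p \<otimes>\<^bsub>adjoin_one S\<^esub> q \<in> W"
      using pq by simp_all
    consider "p = None" | "q = None" | x y where "p = Some x" "q = Some y"
      by (cases p; cases q) auto
    then show "\<exists>U U'. openin ?Y U \<and> openin ?Y U' \<and> p \<in> U \<and> q \<in> U' \<and>
        U \<times> U' \<subseteq> {r \<in> topspace (prod_topology ?Y ?Y). ?m r \<in> W}"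
    proof cases
      assume "p = None"
      then show ?thesis using mem W WX(2) None unit
        by (intro exI[of _ "{None}"] exI[of _ W]) auto
    next
      assume "q = None"
      then show ?thesis using mem W WX(2) None unit
        by (intro exI[of _ W] exI[of _ "{None}"]) auto
    next
      fix x y assume xy: "p = Some x" "q = Some y"
      have op: "openin (prod_topology X X) {r \<in> topspace (prod_topology X X). (\<lambda>(x, y). x \<cdot>\<^bsub>S\<^esub> y) r \<in> Some -` W}"
        using cont WX(1) by (rule openin_continuous_map_preimage)
      have xy_mem: "(x, y) \<in> {r \<in> topspace (prod_topology X X). (\<lambda>(x, y). x \<cdot>\<^bsub>S\<^esub> y) r \<in> Some -` W}"
        using pq xy by (auto simp: topspace_adjoin_point adjoin_one_def)
      from op[unfolded openin_prod_topology_alt, rule_format, OF xy_mem]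
      obtain U U' where U: "openin X U" "openin X U'" "x \<in> U" "y \<in> U'"
          "U \<times> U' \<subseteq> {r \<in> topspace (prod_topology X X). (\<lambda>(x, y). x \<cdot>\<^bsub>S\<^esub> y) r \<in> Some -` W}"
        by blast
      then show ?thesis
        using xy by (intro exI[of _ "Some ` U"] exI[of _ "Some ` U'"])
          (auto simp: openin_adjoin_point_Some topspace_adjoin_point adjoin_one_def)
    qed
  qed
  then show ?thesis
    using closed unfolding continuous_map
    by (auto simp: topspace_adjoin_point X adjoin_one_def split: option.splits)
qed

section \<open>The topology of the free pro-\<open>V\<close> monoid\<close>

definition free_pro1_topology :: "nat semigrp set \<Rightarrow> 'a set \<Rightarrow> 'a pro_elt option topology" where
  "free_pro1_topology V A = adjoin_point_topology (free_pro_topology V A)"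

definition pro_word1 :: "nat semigrp set \<Rightarrow> 'a set \<Rightarrow> 'a list \<Rightarrow> 'a pro_elt option" where
  "pro_word1 V A w = (if w = [] then None else Some (pro_word V A w))"

lemma topspace_free_pro1: "topspace (free_pro1_topology V A) = carrier (free_pro1 V A)"
  by (simp add: free_pro1_topology_def topspace_adjoin_point topspace_free_pro free_pro1_def adjoin_one_def)

lemma compact_free_pro1: "pseudovariety V \<Longrightarrow> compact_space (free_pro1_topology V A)"
  by (simp add: free_pro1_topology_def compact_space_adjoin_point compact_free_pro)

lemma Hausdorff_free_pro1: "Hausdorff_space (free_pro1_topology V A)"
  unfolding free_pro1_topology_def free_pro_topology_def pro_product_topology_def
  by (intro Hausdorff_space_adjoin_point Hausdorff_space_subtopology)
    (simp add: Hausdorff_space_product_topology)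

lemma continuous_map_free_pro1_mult:
  assumes V: "pseudovariety V"
    and f: "continuous_map Z (free_pro1_topology V A) f" and g: "continuous_map Z (free_pro1_topology V A) g"
  shows "continuous_map Z (free_pro1_topology V A) (\<lambda>z. f z \<otimes>\<^bsub>free_pro1 V A\<^esub> g z)"
proof -
  let ?X = "free_pro_topology V A"
  have "continuous_map (prod_topology ?X ?X) ?X (\<lambda>(x, y). x \<cdot>\<^bsub>free_pro V A\<^esub> y)"
    unfolding free_pro_topology_def subtopology_Times[symmetric]
    using free_pro_mult_closed[OF V]
    by (intro continuous_map_into_subtopology continuous_map_from_subtopology continuous_map_pro_mult[OF V]) auto
  then have "continuous_map (prod_topology (free_pro1_topology V A) (free_pro1_topology V A))
      (free_pro1_topology V A) (\<lambda>(p, q). p \<otimes>\<^bsub>free_pro1 V A\<^esub> q)"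
    unfolding free_pro1_topology_def free_pro1_def
    by (intro continuous_map_adjoin_one_mult topspace_free_pro)
  from continuous_map_compose[OF continuous_map_pairedI[OF f g] this]
  show ?thesis by (simp add: comp_def)
qed

lemma pro_word1_closed: "w \<in> lists A \<Longrightarrow> pro_word1 V A w \<in> carrier (free_pro1 V A)"
  using pro_word_in_free_pro[of w A V]
  by (auto simp: pro_word1_def free_pro1_def adjoin_one_def free_semigroup_def)

lemma letter_eq_pro_word1: "letter V A a = pro_word1 V A [a]"
  by (simp add: letter_def pro_word1_def)

lemma pro_word1_append:
  assumes "u \<in> lists A" "v \<in> lists A"
  shows "pro_word1 V A (u @ v) = pro_word1 V A u \<otimes>\<^bsub>free_pro1 V A\<^esub> pro_word1 V A v"
  using assms pro_word_append[of u A v V]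
  by (auto simp: pro_word1_def free_pro1_def adjoin_one_def free_semigroup_def)

lemma pro_word1_marked_product:
  assumes "u \<in> lists A" "v \<in> lists A" "a \<in> A"
  shows "pro_word1 V A (u @ [a] @ v) =
    pro_word1 V A u \<otimes>\<^bsub>free_pro1 V A\<^esub> letter V A a \<otimes>\<^bsub>free_pro1 V A\<^esub> pro_word1 V A v"
  using assms pro_word1_append[of "u @ [a]" A v V] pro_word1_append[of u A "[a]" V]
  by (simp add: letter_eq_pro_word1)

lemma pro_word1_dense:
  assumes "openin (free_pro1_topology V A) U" "p \<in> U"
  obtains w where "w \<in> lists A" "pro_word1 V A w \<in> U"
proof (cases p)
  case None
  then show ?thesis using that[of "[]"] assms by (simp add: pro_word1_def)
next
  case (Some y)
  have "openin (free_pro_topology V A) (Some -` U)"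
    using assms(1) by (simp add: free_pro1_topology_def openin_adjoin_point)
  then obtain T where T: "openin (pro_product_topology V A) T" "Some -` U = T \<inter> carrier (free_pro V A)"
    unfolding free_pro_topology_def openin_subtopology by blast
  then have "y \<in> T" "y \<in> pro_product_topology V A closure_of (pro_word V A ` carrier (free_semigroup A))"
    using Some assms(2) by (auto simp: free_pro_def)
  then obtain w where w: "w \<in> carrier (free_semigroup A)" "pro_word V A w \<in> T"
    using T(1) unfolding in_closure_of by blast
  then have "pro_word V A w \<in> Some -` U" using T(2) pro_word_in_free_pro by blast
  then show ?thesis using w that[of w] by (simp add: pro_word1_def free_semigroup_def)
qed

text \<open>
  A basic open set of the product topology restricts finitely many coordinates, and fixing those
  coordinates at their values in \<open>y\<close> is a stronger condition.
\<close>

lemma free_pro_cylinder_neighbourhood: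
  assumes "openin (free_pro_topology V A) U" "y \<in> U"
  obtains F where "finite F" "F \<subseteq> pro_homs V A"
    "{y' \<in> carrier (free_pro V A). \<forall>i\<in>F. y' i = y i} \<subseteq> U"
proof -
  let ?I = "pro_homs V A" and ?X = "\<lambda>i. discrete_topology (carrier (fst i))"
  obtain T where T: "openin (product_topology ?X ?I) T" "U = T \<inter> carrier (free_pro V A)"
    using assms(1) unfolding free_pro_topology_def openin_subtopology pro_product_topology_def by blast
  then have "y \<in> T" using assms(2) by simp
  then obtain B where B: "finite {i \<in> ?I. B i \<noteq> topspace (?X i)}" "y \<in> Pi\<^sub>E ?I B" "Pi\<^sub>E ?I B \<subseteq> T"
    using T(1) unfolding openin_product_topology_alt by blast
  let ?F = "{i \<in> ?I. B i \<noteq> topspace (?X i)}"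
  have "y' \<in> T" if y': "y' \<in> carrier (free_pro V A)" "\<forall>i\<in>?F. y' i = y i" for y'
  proof -
    have "y' \<in> (\<Pi>\<^sub>E i\<in>?I. carrier (fst i))"
      using y'(1) carrier_free_pro_subset unfolding topspace_pro_product by blast
    moreover have "y' i \<in> B i" if "i \<in> ?I" for i
    proof (cases "i \<in> ?F")
      case True
      then have "y' i = y i" using y'(2) by blast
      then show ?thesis using B(2) that by (simp add: PiE_iff)
    next
      case False
      then show ?thesis using that free_pro_component[OF y'(1) that] by simp
    qed
    ultimately have "y' \<in> Pi\<^sub>E ?I B" by (simp add: PiE_iff)
    then show ?thesis using B(3) by blast
  qed
  then have "{y' \<in> carrier (free_pro V A). \<forall>i\<in>?F. y' i = y i} \<subseteq> U"
    using T(2) by blast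
  then show ?thesis using that B(1) by blast
qed

lemma openin_free_pro_cylinder:
  assumes "finite F" "F \<subseteq> pro_homs V A"
  shows "openin (free_pro_topology V A) {y' \<in> carrier (free_pro V A). \<forall>i\<in>F. y' i \<in> B i}"
  using assms
proof (induction F)
  case empty
  then show ?case using openin_topspace[of "free_pro_topology V A"] by (simp add: topspace_free_pro)
next
  case (insert i F)
  then have i: "i \<in> pro_homs V A" by simp
  have "continuous_map (free_pro_topology V A) (discrete_topology (carrier (fst i))) (\<lambda>x. x i)"
    unfolding free_pro_topology_def
    using continuous_map_free_pro_projection[OF i] by (rule continuous_map_from_subtopology)
  from openin_continuous_map_preimage[OF this, of "carrier (fst i) \<inter> B i"]
  have "openin (free_pro_topology V A) {x \<in> carrier (free_pro V A). x i \<in> carrier (fst i) \<inter> B i}"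
    by (simp add: topspace_free_pro)
  from openin_Int[OF this insert.IH]
  have "openin (free_pro_topology V A) ({x \<in> carrier (free_pro V A). x i \<in> carrier (fst i) \<inter> B i} \<inter>
      {y' \<in> carrier (free_pro V A). \<forall>i\<in>F. y' i \<in> B i})" using insert.prems by simp
  moreover have "{x \<in> carrier (free_pro V A). x i \<in> carrier (fst i) \<inter> B i} \<inter>
      {y' \<in> carrier (free_pro V A). \<forall>i\<in>F. y' i \<in> B i} =
      {y' \<in> carrier (free_pro V A). \<forall>i\<in>insert i F. y' i \<in> B i}"
    using free_pro_component[OF _ i] by blast
  ultimately show ?case by simp
qed

text \<open>
  For \<open>p\<close> in the semigroup a small cylinder serves. The adjoined point has \<open>{None}\<close> as a neighbourhood,
  and the empty word is the only word in it; this is where the language \<open>{1}\<close>, which is not a subset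
  of \<open>A\<^sup>+\<close>, enters.
\<close>

lemma recognizable_neighbourhood:
  assumes V: "pseudovariety V" and U: "openin (free_pro1_topology V A) U" "p \<in> U"
  obtains N where "openin (free_pro1_topology V A) N" "p \<in> N" "N \<subseteq> U"
    "recognizable V A {w \<in> lists A. pro_word1 V A w \<in> N} \<or> {w \<in> lists A. pro_word1 V A w \<in> N} = {[]}"
proof (cases p)
  case None
  have "{w \<in> lists A. pro_word1 V A w \<in> {None}} = {[]}"
    by (auto simp: pro_word1_def split: if_splits)
  then show ?thesis
    using that[of "{None}"] None U by (simp add: free_pro1_topology_def openin_adjoin_point_None)
next
  case (Some y)
  have y: "openin (free_pro_topology V A) (Some -` U)" "y \<in> Some -` U"
    using U Some by (auto simp: free_pro1_topology_def openin_adjoin_point)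
  then obtain F where F: "finite F" "F \<subseteq> pro_homs V A"
      "{y' \<in> carrier (free_pro V A). \<forall>i\<in>F. y' i = y i} \<subseteq> Some -` U"
    by (rule free_pro_cylinder_neighbourhood)
  let ?N = "{y' \<in> carrier (free_pro V A). \<forall>i\<in>F. y' i = y i}"
  have yc: "y \<in> carrier (free_pro V A)"
    using y openin_subset[OF y(1)] by (auto simp: topspace_free_pro)
  have op: "openin (free_pro_topology V A) ?N"
    using openin_free_pro_cylinder[OF F(1,2), of "\<lambda>i. {y i}"] by simp
  have "pro_word1 V A w \<in> Some ` ?N \<longleftrightarrow> w \<noteq> [] \<and> (\<forall>i\<in>F. snd i w = y i)" if "w \<in> lists A" for w
  proof (cases "w = []")
    case False
    have "pro_word V A w i = snd i w" if "i \<in> F" for i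
      using that F(2) by (auto simp: pro_word_def)
    then show ?thesis
      using False that pro_word_in_free_pro[of w A V]
      by (auto simp: pro_word1_def free_semigroup_def inj_image_mem_iff)
  qed (auto simp: pro_word1_def)
  then have "{w \<in> lists A. pro_word1 V A w \<in> Some ` ?N} =
      {w \<in> carrier (free_semigroup A). \<forall>i\<in>F. snd i w = y i}"
    unfolding free_semigroup_def by auto
  then have "recognizable V A {w \<in> lists A. pro_word1 V A w \<in> Some ` ?N}"
    using recognizable_pro_homs_cylinder[OF V F(1,2)] by simp
  moreover have "openin (free_pro1_topology V A) (Some ` ?N)"
    using op by (simp add: free_pro1_topology_def openin_adjoin_point_Some)
  moreover have "p \<in> Some ` ?N" "Some ` ?N \<subseteq> U" using Some yc F(3) by auto
  ultimately show ?thesis using that by blast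
qed

text \<open>
  A homomorphism recognizing \<open>L\<close> is one of the coordinates of the pro-\<open>V\<close> completion, and a condition
  on a single discrete coordinate is clopen.
\<close>

lemma recognizable_clopen:
  assumes V: "pseudovariety V" and L: "recognizable V A L"
  obtains C where "openin (free_pro1_topology V A) C" "closedin (free_pro1_topology V A) C"
    "\<And>w. w \<in> lists A \<Longrightarrow> pro_word1 V A w \<in> C \<longleftrightarrow> w \<in> L"
proof -
  obtain S \<phi> where S: "S \<in> V" "\<phi> \<in> sg_hom (free_semigroup A) S"
      "L = {w \<in> carrier (free_semigroup A). \<phi> w \<in> \<phi> ` L}"
    using L unfolding recognizable_def by blast
  let ?i = "(S, restrict \<phi> (carrier (free_semigroup A)))"
  have "restrict \<phi> (carrier (free_semigroup A)) \<in> sg_hom (free_semigroup A) S"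
    using S(2) by (auto simp: sg_hom_def free_semigroup_def)
  then have i: "?i \<in> pro_homs V A" using S(1) by (simp add: pro_homs_def)
  define P where "P B = Some ` {y \<in> carrier (free_pro V A). y ?i \<in> B}" for B
  have op: "openin (free_pro1_topology V A) (P B)" for B
    using openin_free_pro_cylinder[of "{?i}" V A "\<lambda>_. B"] i
    by (simp add: P_def free_pro1_topology_def openin_adjoin_point_Some)
  have "openin (free_pro1_topology V A) ({None} \<union> P (- (\<phi> ` L)))"
    using op openin_adjoin_point_None by (metis free_pro1_topology_def openin_Un)
  moreover have "{None} \<union> P (- (\<phi> ` L)) = topspace (free_pro1_topology V A) - P (\<phi> ` L)"
    by (auto simp: P_def topspace_free_pro1 free_pro1_def adjoin_one_def)
  moreover have "P (\<phi> ` L) \<subseteq> topspace (free_pro1_topology V A)"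
    using op by (rule openin_subset)
  ultimately have cl: "closedin (free_pro1_topology V A) (P (\<phi> ` L))"
    by (simp add: closedin_def)
  have "pro_word1 V A w \<in> P (\<phi> ` L) \<longleftrightarrow> w \<in> L" if w: "w \<in> lists A" for w
  proof (cases "w = []")
    case True
    then show ?thesis using L by (auto simp: pro_word1_def P_def recognizable_def free_semigroup_def)
  next
    case False
    then have wc: "w \<in> carrier (free_semigroup A)" using w by (simp add: free_semigroup_def)
    then have "pro_word V A w ?i = \<phi> w" using i by (simp add: pro_word_def)
    then have "pro_word1 V A w \<in> P (\<phi> ` L) \<longleftrightarrow> \<phi> w \<in> \<phi> ` L"
      using False pro_word_in_free_pro[OF wc] by (simp add: pro_word1_def P_def inj_image_mem_iff)
    also have "\<dots> \<longleftrightarrow> w \<in> L" using S(3) wc by blast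
    finally show ?thesis .
  qed
  then show ?thesis using that op cl by blast
qed

section \<open>Words near a good factorization\<close>

lemma closedin_continuous_image_compact:
  assumes "compact_space X" "Hausdorff_space Y" "continuous_map X Y f"
  shows "closedin Y (f ` topspace X)"
  using assms by (metis compact_space_def compactin_imp_closedin image_compactin)

text \<open>
  The relation consisting of the pairs \<open>(f (q, z), q)\<close> is closed, as a continuous image of a compact
  space, and does not contain \<open>(p, p)\<close>. A square neighbourhood of \<open>(p, p)\<close> avoiding it is what is
  wanted.
\<close>

lemma neighbourhood_moved_off_itself:
  assumes Y: "compact_space Y" "Hausdorff_space Y" and Z: "compact_space Z"
    and f: "continuous_map (prod_topology Y Z) Y f"
    and p: "p \<in> topspace Y" "\<And>z. z \<in> topspace Z \<Longrightarrow> f (p, z) \<noteq> p"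
  obtains U where "openin Y U" "p \<in> U" "\<And>q z. q \<in> U \<Longrightarrow> z \<in> topspace Z \<Longrightarrow> f (q, z) \<notin> U"
proof -
  let ?g = "\<lambda>r. (f r, fst r)" and ?Y2 = "prod_topology Y Y"
  let ?G = "?g ` topspace (prod_topology Y Z)"
  have "closedin ?Y2 ?G"
    using Y Z f by (intro closedin_continuous_image_compact continuous_map_pairedI continuous_map_fst)
      (auto simp: compact_space_prod_topology Hausdorff_space_prod_topology)
  then have op: "openin ?Y2 (topspace ?Y2 - ?G)" by blast
  have mem: "(p, p) \<in> topspace ?Y2 - ?G"
    using p by (auto simp del: topspace_prod_topology) (auto simp: eq_commute)
  from op[unfolded openin_prod_topology_alt, rule_format, OF mem]
  obtain U1 U2 where U: "openin Y U1" "openin Y U2" "p \<in> U1" "p \<in> U2" "U1 \<times> U2 \<subseteq> topspace ?Y2 - ?G"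
    by blast
  show ?thesis
  proof (rule that[of "U1 \<inter> U2"])
    fix q z assume q: "q \<in> U1 \<inter> U2" and z: "z \<in> topspace Z"
    then have "(q, z) \<in> topspace (prod_topology Y Z)" using openin_subset[OF U(1)] by auto
    then have "(f (q, z), q) \<in> ?G" by (rule rev_image_eqI) simp
    then show "f (q, z) \<notin> U1 \<inter> U2" using U(5) q by blast
  qed (use U in auto)
qed

text \<open>
  The strict inequality says that \<open>p\<close> is not of the form \<open>p c m\<close>; the preceding lemma extends this to
  a neighbourhood of \<open>p\<close>.
\<close>

lemma R_less_neighbourhood:
  assumes V: "pseudovariety V" and c: "c \<in> carrier (free_pro1 V A)" and p: "p \<in> carrier (free_pro1 V A)"
    and less: "R_less (free_pro1 V A) (p \<otimes>\<^bsub>free_pro1 V A\<^esub> c) p"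
  obtains U where "openin (free_pro1_topology V A) U" "p \<in> U"
    "\<And>q m. q \<in> U \<Longrightarrow> m \<in> carrier (free_pro1 V A) \<Longrightarrow>
       q \<otimes>\<^bsub>free_pro1 V A\<^esub> c \<otimes>\<^bsub>free_pro1 V A\<^esub> m \<notin> U"
proof (rule neighbourhood_moved_off_itself[OF compact_free_pro1[OF V] Hausdorff_free_pro1 compact_free_pro1[OF V]])
  let ?M = "free_pro1 V A" and ?Y = "free_pro1_topology V A"
  show "continuous_map (prod_topology ?Y ?Y) ?Y (\<lambda>r. fst r \<otimes>\<^bsub>?M\<^esub> c \<otimes>\<^bsub>?M\<^esub> snd r)"
    using c by (intro continuous_map_free_pro1_mult[OF V] continuous_map_fst continuous_map_snd)
      (simp add: topspace_free_pro1)
  show "fst (p, m) \<otimes>\<^bsub>?M\<^esub> c \<otimes>\<^bsub>?M\<^esub> snd (p, m) \<noteq> p" if "m \<in> topspace ?Y" for m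
    using less that by (auto simp: R_less_def R_le_def topspace_free_pro1)
qed (use p that in \<open>auto simp: topspace_free_pro1\<close>)

lemma L_less_neighbourhood:
  assumes V: "pseudovariety V" and c: "c \<in> carrier (free_pro1 V A)" and p: "p \<in> carrier (free_pro1 V A)"
    and less: "L_less (free_pro1 V A) (c \<otimes>\<^bsub>free_pro1 V A\<^esub> p) p"
  obtains U where "openin (free_pro1_topology V A) U" "p \<in> U"
    "\<And>q m. q \<in> U \<Longrightarrow> m \<in> carrier (free_pro1 V A) \<Longrightarrow>
       m \<otimes>\<^bsub>free_pro1 V A\<^esub> (c \<otimes>\<^bsub>free_pro1 V A\<^esub> q) \<notin> U"
proof (rule neighbourhood_moved_off_itself[OF compact_free_pro1[OF V] Hausdorff_free_pro1 compact_free_pro1[OF V]])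
  let ?M = "free_pro1 V A" and ?Y = "free_pro1_topology V A"
  show "continuous_map (prod_topology ?Y ?Y) ?Y (\<lambda>r. snd r \<otimes>\<^bsub>?M\<^esub> (c \<otimes>\<^bsub>?M\<^esub> fst r))"
    using c by (intro continuous_map_free_pro1_mult[OF V] continuous_map_fst continuous_map_snd)
      (simp add: topspace_free_pro1)
  show "snd (p, m) \<otimes>\<^bsub>?M\<^esub> (c \<otimes>\<^bsub>?M\<^esub> fst (p, m)) \<noteq> p" if "m \<in> topspace ?Y" for m
    using less that by (auto simp: L_less_def L_le_def topspace_free_pro1)
qed (use p that in \<open>auto simp: topspace_free_pro1\<close>)

lemma free_monoid_equidivisible:
  assumes "u @ [a] @ v = w @ [b] @ z" "u @ [a] @ v \<in> lists A"
  shows "(u = w \<and> a = b \<and> v = z) \<or>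
    (\<exists>t\<in>lists A. u = w @ [b] @ t \<and> z = t @ [a] @ v) \<or>
    (\<exists>t\<in>lists A. w = u @ [a] @ t \<and> v = t @ [b] @ z)"
proof -
  obtain s where "u = w @ s \<and> s @ [a] @ v = [b] @ z \<or> u @ s = w \<and> [a] @ v = s @ [b] @ z"
    using assms(1) unfolding append_eq_append_conv2 by blast
  then show ?thesis using assms(2) by (cases s) auto
qed

text \<open>
  Multiplication is open at a good factorization, as far as words are concerned: the words close to
  \<open>x\<close> are exactly those of a language \<open>L a K\<close> in which \<open>L\<close> and \<open>K\<close> consist of words close to \<open>u\<close> and
  \<open>v\<close>. The strict inequalities make \<open>L a\<close> a prefix code and \<open>a K\<close> a suffix code for small
  neighbourhoods, and then closure under bideterministic product makes \<open>L a K\<close> the set of words of a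
  clopen set.
\<close>

lemma marked_product_neighbourhood:
  assumes V: "pseudovariety V" "closed_bideterministic V" and A: "finite A"
    and good: "good_factorization V A x (u, a, v)"
    and U: "openin (free_pro1_topology V A) U" "u \<in> U"
    and U': "openin (free_pro1_topology V A) U'" "v \<in> U'"
  obtains C where "openin (free_pro1_topology V A) C" "Some x \<in> C"
    "\<And>y. y \<in> lists A \<Longrightarrow> pro_word1 V A y \<in> C \<Longrightarrow>
       \<exists>l\<in>lists A. \<exists>k\<in>lists A. pro_word1 V A l \<in> U \<and> pro_word1 V A k \<in> U' \<and> y = l @ [a] @ k"
proof -
  let ?M = "free_pro1 V A" and ?Y = "free_pro1_topology V A" and ?w = "pro_word1 V A"
  let ?c = "letter V A a"
  have uv: "u \<in> carrier ?M" "a \<in> A" "v \<in> carrier ?M" "Some x = u \<otimes>\<^bsub>?M\<^esub> ?c \<otimes>\<^bsub>?M\<^esub> v"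
    and less: "R_less ?M (u \<otimes>\<^bsub>?M\<^esub> ?c) u" "L_less ?M (?c \<otimes>\<^bsub>?M\<^esub> v) v"
    using good by (simp_all add: good_factorization_def)
  interpret M: monoid ?M using V(1) uv(2) by (intro free_pro1_monoid) auto
  have c: "?c \<in> carrier ?M" using uv(2) by (simp add: letter_eq_pro_word1 pro_word1_closed)
  obtain R where R: "openin ?Y R" "u \<in> R"
      "\<And>q m. q \<in> R \<Longrightarrow> m \<in> carrier ?M \<Longrightarrow> q \<otimes>\<^bsub>?M\<^esub> ?c \<otimes>\<^bsub>?M\<^esub> m \<notin> R"
    using R_less_neighbourhood[OF V(1) c uv(1) less(1)] by blast
  obtain R' where R': "openin ?Y R'" "v \<in> R'"
      "\<And>q m. q \<in> R' \<Longrightarrow> m \<in> carrier ?M \<Longrightarrow> m \<otimes>\<^bsub>?M\<^esub> (?c \<otimes>\<^bsub>?M\<^esub> q) \<notin> R'"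
    using L_less_neighbourhood[OF V(1) c uv(3) less(2)] by blast
  \<comment> \<open>\<open>U\<close> keeps the words of \<open>L\<close> close to \<open>u\<close>, and \<open>R\<close> makes \<open>L a\<close> a prefix code.\<close>
  have "openin ?Y (U \<inter> R)" "u \<in> U \<inter> R" using U R by auto
  then obtain N where N: "openin ?Y N" "u \<in> N" "N \<subseteq> U \<inter> R"
      "recognizable V A {w \<in> lists A. ?w w \<in> N} \<or> {w \<in> lists A. ?w w \<in> N} = {[]}"
    by (rule recognizable_neighbourhood[OF V(1)])
  have "openin ?Y (U' \<inter> R')" "v \<in> U' \<inter> R'" using U' R' by auto
  then obtain N' where N': "openin ?Y N'" "v \<in> N'" "N' \<subseteq> U' \<inter> R'"
      "recognizable V A {w \<in> lists A. ?w w \<in> N'} \<or> {w \<in> lists A. ?w w \<in> N'} = {[]}"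
    by (rule recognizable_neighbourhood[OF V(1)])
  let ?L = "{w \<in> lists A. ?w w \<in> N}" and ?K = "{w \<in> lists A. ?w w \<in> N'}"
  have LK: "?L \<subseteq> lists A" "?K \<subseteq> lists A" by auto
  have "prefix_code A {l @ [a] | l. l \<in> ?L}"
    unfolding prefix_code_marked_iff[OF LK(1) uv(2)]
  proof (intro ballI notI)
    fix l s assume l: "l \<in> ?L" and s: "s \<in> lists A" and "l @ [a] @ s \<in> ?L"
    then have "?w (l @ [a] @ s) \<in> R" using N(3) by blast
    then have "?w l \<otimes>\<^bsub>?M\<^esub> ?c \<otimes>\<^bsub>?M\<^esub> ?w s \<in> R"
      using l s uv(2) pro_word1_marked_product[of l A s a V] by simp
    then show False using R(3)[OF _ pro_word1_closed[OF s], of "?w l"] l N(3) by blast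
  qed
  moreover have "suffix_code A {[a] @ k | k. k \<in> ?K}"
    unfolding suffix_code_marked_iff[OF LK(2) uv(2)]
  proof (intro ballI notI)
    fix k s assume k: "k \<in> ?K" and s: "s \<in> lists A" and "s @ [a] @ k \<in> ?K"
    then have "?w (s @ [a] @ k) \<in> R'" using N'(3) by blast
    then have "?w s \<otimes>\<^bsub>?M\<^esub> (?c \<otimes>\<^bsub>?M\<^esub> ?w k) \<in> R'"
      using k s c uv(2) pro_word1_marked_product[of s A k a V]
      by (simp add: M.m_assoc pro_word1_closed)
    then show False using R'(3)[OF _ pro_word1_closed[OF s], of "?w k"] k N'(3) by blast
  qed
  ultimately have "recognizable V A {l @ [a] @ k | l k. l \<in> ?L \<and> k \<in> ?K}"
    by (rule closed_bideterministic_alphabet[OF V(2) A uv(2) N(4) N'(4)])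
  then obtain C where C: "openin ?Y C" "closedin ?Y C"
      "\<And>w. w \<in> lists A \<Longrightarrow> ?w w \<in> C \<longleftrightarrow> w \<in> {l @ [a] @ k | l k. l \<in> ?L \<and> k \<in> ?K}"
    by (rule recognizable_clopen[OF V(1)]) blast
  \<comment> \<open>\<open>x\<close> is a limit of words \<open>l a k\<close> with \<open>l\<close> in \<open>L\<close> and \<open>k\<close> in \<open>K\<close>, and \<open>C\<close> is closed.\<close>
  have "Some x \<in> C"
  proof (rule ccontr)
    assume "Some x \<notin> C"
    let ?f = "\<lambda>r. fst r \<otimes>\<^bsub>?M\<^esub> ?c \<otimes>\<^bsub>?M\<^esub> snd r"
    have f: "continuous_map (prod_topology ?Y ?Y) ?Y ?f"
      using c by (intro continuous_map_free_pro1_mult[OF V(1)] continuous_map_fst continuous_map_snd)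
        (simp add: topspace_free_pro1)
    let ?O = "{r \<in> topspace (prod_topology ?Y ?Y). ?f r \<in> topspace ?Y - C}"
    have O: "openin (prod_topology ?Y ?Y) ?O"
      using f C(2) by (intro openin_continuous_map_preimage) auto
    have "?f (u, v) \<in> topspace ?Y"
      using uv(1,3) c by (simp add: topspace_free_pro1)
    then have "(u, v) \<in> ?O"
      using uv \<open>Some x \<notin> C\<close> by (simp add: topspace_free_pro1)
    from O[unfolded openin_prod_topology_alt, rule_format, OF this]
    obtain T T' where T: "openin ?Y T" "openin ?Y T'" "u \<in> T" "v \<in> T'" "T \<times> T' \<subseteq> ?O" by blast
    have "openin ?Y (T \<inter> N)" "u \<in> T \<inter> N" using T N by auto
    then obtain l where l: "l \<in> lists A" "?w l \<in> T \<inter> N" by (rule pro_word1_dense)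
    have "openin ?Y (T' \<inter> N')" "v \<in> T' \<inter> N'" using T N' by auto
    then obtain k where k: "k \<in> lists A" "?w k \<in> T' \<inter> N'" by (rule pro_word1_dense)
    have "(?w l, ?w k) \<in> ?O" using l k T(5) by blast
    then have "?w (l @ [a] @ k) \<notin> C"
      using pro_word1_marked_product[OF l(1) k(1) uv(2), of V] by simp
    moreover have "l @ [a] @ k \<in> {l @ [a] @ k | l k. l \<in> ?L \<and> k \<in> ?K}" using l k by blast
    moreover have "l @ [a] @ k \<in> lists A" using l k uv(2) by simp
    ultimately show False using C(3) by blast
  qed
  moreover have "\<exists>l\<in>lists A. \<exists>k\<in>lists A. ?w l \<in> U \<and> ?w k \<in> U' \<and> y = l @ [a] @ k"
    if y: "y \<in> lists A" "?w y \<in> C" for y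
  proof -
    obtain l k where "y = l @ [a] @ k" "l \<in> ?L" "k \<in> ?K" using C(3)[OF y(1)] y(2) by blast
    then show ?thesis using N(3) N'(3) by blast
  qed
  ultimately show ?thesis using that C(1) by blast
qed

section \<open>Comparable factorizations\<close>

text \<open>
  The four elements are grouped as a pair of pairs so that neighbourhoods in the product topology
  separate \<open>(u, v)\<close>, which is approximated through the language \<open>L a K\<close>, from \<open>(w, z)\<close>.
\<close>

definition comparable_factorizations ::
  "nat semigrp set \<Rightarrow> 'a set \<Rightarrow> 'a \<Rightarrow> 'a \<Rightarrow>
     (('a pro_elt option \<times> 'a pro_elt option) \<times> ('a pro_elt option \<times> 'a pro_elt option)) set" where
  "comparable_factorizations V A a b =
     {((u, v), (w, z)). {u, v, w, z} \<subseteq> carrier (free_pro1 V A) \<and>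
        ((u = w \<and> a = b \<and> v = z) \<or>
         (\<exists>t\<in>carrier (free_pro1 V A).
            u = w \<otimes>\<^bsub>free_pro1 V A\<^esub> letter V A b \<otimes>\<^bsub>free_pro1 V A\<^esub> t \<and>
            z = t \<otimes>\<^bsub>free_pro1 V A\<^esub> letter V A a \<otimes>\<^bsub>free_pro1 V A\<^esub> v) \<or>
         (\<exists>t\<in>carrier (free_pro1 V A).
            w = u \<otimes>\<^bsub>free_pro1 V A\<^esub> letter V A a \<otimes>\<^bsub>free_pro1 V A\<^esub> t \<and>
            v = t \<otimes>\<^bsub>free_pro1 V A\<^esub> letter V A b \<otimes>\<^bsub>free_pro1 V A\<^esub> z))}"

lemma comparable_factorizations_iff:
  "((u, v), (w, z)) \<in> comparable_factorizations V A a b \<longleftrightarrow>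
     {u, v, w, z} \<subseteq> carrier (free_pro1 V A) \<and>
        ((u = w \<and> a = b \<and> v = z) \<or>
         (\<exists>t\<in>carrier (free_pro1 V A).
            u = w \<otimes>\<^bsub>free_pro1 V A\<^esub> letter V A b \<otimes>\<^bsub>free_pro1 V A\<^esub> t \<and>
            z = t \<otimes>\<^bsub>free_pro1 V A\<^esub> letter V A a \<otimes>\<^bsub>free_pro1 V A\<^esub> v) \<or>
         (\<exists>t\<in>carrier (free_pro1 V A).
            w = u \<otimes>\<^bsub>free_pro1 V A\<^esub> letter V A a \<otimes>\<^bsub>free_pro1 V A\<^esub> t \<and>
            v = t \<otimes>\<^bsub>free_pro1 V A\<^esub> letter V A b \<otimes>\<^bsub>free_pro1 V A\<^esub> z))"
  by (simp only: comparable_factorizations_def mem_Collect_eq case_prod_conv)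

text \<open>
  Each of the three alternatives describes the image of a compact space: the diagonal for the first,
  and the continuous images of \<open>M\<^sup>3\<close> given by \<open>(w, v, t)\<close> and by \<open>(u, z, t)\<close> for the other two.
\<close>

lemma closedin_comparable_factorizations:
  fixes V :: "nat semigrp set" and A :: "'a set" and a b :: 'a
  defines "Y \<equiv> free_pro1_topology V A"
  assumes V: "pseudovariety V" and ab: "a \<in> A" "b \<in> A"
  shows "closedin (prod_topology (prod_topology Y Y) (prod_topology Y Y)) (comparable_factorizations V A a b)"
proof -
  define M c d where "M = free_pro1 V A" and "c = letter V A a" and "d = letter V A b"
  interpret M: monoid M unfolding M_def using V ab by (intro free_pro1_monoid) auto
  have c: "c \<in> carrier M" and d: "d \<in> carrier M"
    using ab by (simp_all add: M_def c_def d_def letter_eq_pro_word1 pro_word1_closed)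
  note defs = M_def[symmetric] c_def[symmetric] d_def[symmetric]
  let ?Y2 = "prod_topology Y Y"
  let ?Y3 = "prod_topology ?Y2 Y" and ?Y4 = "prod_topology ?Y2 ?Y2"
  let ?e = "\<lambda>r. (r, r)"
  let ?f = "\<lambda>((w, v), t). ((w \<otimes>\<^bsub>M\<^esub> d \<otimes>\<^bsub>M\<^esub> t, v), (w, t \<otimes>\<^bsub>M\<^esub> c \<otimes>\<^bsub>M\<^esub> v))"
  let ?g = "\<lambda>((u, z), t). ((u, t \<otimes>\<^bsub>M\<^esub> d \<otimes>\<^bsub>M\<^esub> z), (u \<otimes>\<^bsub>M\<^esub> c \<otimes>\<^bsub>M\<^esub> t, z))"
  have Y: "compact_space Y" "Hausdorff_space Y" "topspace Y = carrier M"
    using V by (simp_all add: Y_def M_def compact_free_pro1 Hausdorff_free_pro1 topspace_free_pro1)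
  note mult = continuous_map_free_pro1_mult[OF V, where A = A, folded Y_def M_def]
  have const: "continuous_map ?Y3 Y (\<lambda>_. c)" "continuous_map ?Y3 Y (\<lambda>_. d)"
    using c d Y(3) by simp_all
  have proj: "continuous_map ?Y3 Y (\<lambda>r. fst (fst r))" "continuous_map ?Y3 Y (\<lambda>r. snd (fst r))"
      "continuous_map ?Y3 Y (\<lambda>r. snd r)"
    using continuous_map_compose[OF continuous_map_fst continuous_map_fst, of Y Y Y]
      continuous_map_compose[OF continuous_map_fst continuous_map_snd, of Y Y Y] continuous_map_snd[of ?Y2 Y]
    by (simp_all add: comp_def)
  have "closedin ?Y4 (?e ` topspace ?Y2)"
    using Y by (intro closedin_continuous_image_compact)
      (simp_all add: compact_space_prod_topology Hausdorff_space_prod_topology continuous_map_pairedI)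
  then have e: "closedin ?Y4 (if a = b then ?e ` topspace ?Y2 else {})" by simp
  have "continuous_map ?Y3 ?Y4 ?f"
    unfolding split_beta by (intro continuous_map_pairedI mult const proj)
  then have f: "closedin ?Y4 (?f ` topspace ?Y3)"
    using Y by (intro closedin_continuous_image_compact)
      (simp_all add: compact_space_prod_topology Hausdorff_space_prod_topology)
  have "continuous_map ?Y3 ?Y4 ?g"
    unfolding split_beta by (intro continuous_map_pairedI mult const proj)
  then have g: "closedin ?Y4 (?g ` topspace ?Y3)"
    using Y by (intro closedin_continuous_image_compact)
      (simp_all add: compact_space_prod_topology Hausdorff_space_prod_topology)
  have "comparable_factorizations V A a b =
      (if a = b then ?e ` topspace ?Y2 else {}) \<union> ?f ` topspace ?Y3 \<union> ?g ` topspace ?Y3" (is "_ = ?R")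
  proof (rule subset_antisym)
    show "comparable_factorizations V A a b \<subseteq> ?R"
    proof
      fix q assume "q \<in> comparable_factorizations V A a b"
      moreover obtain u v w z where q: "q = ((u, v), (w, z))" by (metis prod.exhaust)
      ultimately have car: "u \<in> carrier M" "v \<in> carrier M" "w \<in> carrier M" "z \<in> carrier M"
        and cases: "(u = w \<and> a = b \<and> v = z) \<or>
          (\<exists>t\<in>carrier M. u = w \<otimes>\<^bsub>M\<^esub> d \<otimes>\<^bsub>M\<^esub> t \<and> z = t \<otimes>\<^bsub>M\<^esub> c \<otimes>\<^bsub>M\<^esub> v) \<or>
          (\<exists>t\<in>carrier M. w = u \<otimes>\<^bsub>M\<^esub> c \<otimes>\<^bsub>M\<^esub> t \<and> v = t \<otimes>\<^bsub>M\<^esub> d \<otimes>\<^bsub>M\<^esub> z)"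
        unfolding q comparable_factorizations_iff defs by simp_all
      from cases show "q \<in> ?R"
      proof (elim disjE bexE)
        assume "u = w \<and> a = b \<and> v = z"
        then show ?thesis using q car Y(3) by simp
      next
        fix t assume "t \<in> carrier M" "u = w \<otimes>\<^bsub>M\<^esub> d \<otimes>\<^bsub>M\<^esub> t \<and> z = t \<otimes>\<^bsub>M\<^esub> c \<otimes>\<^bsub>M\<^esub> v"
        then have "q = ?f ((w, v), t)" "((w, v), t) \<in> topspace ?Y3" using q car Y(3) by simp_all
        then show ?thesis by blast
      next
        fix t assume "t \<in> carrier M" "w = u \<otimes>\<^bsub>M\<^esub> c \<otimes>\<^bsub>M\<^esub> t \<and> v = t \<otimes>\<^bsub>M\<^esub> d \<otimes>\<^bsub>M\<^esub> z"
        then have "q = ?g ((u, z), t)" "((u, z), t) \<in> topspace ?Y3" using q car Y(3) by simp_all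
        then show ?thesis by blast
      qed
    qed
    have "?f ((w, v), t) \<in> comparable_factorizations V A a b"
      if "w \<in> carrier M" "v \<in> carrier M" "t \<in> carrier M" for w v t
      unfolding prod.case comparable_factorizations_iff defs using that c d
      by (intro conjI disjI2 disjI1 bexI[of _ t]) simp_all
    moreover have "?g ((u, z), t) \<in> comparable_factorizations V A a b"
      if "u \<in> carrier M" "z \<in> carrier M" "t \<in> carrier M" for u z t
      unfolding prod.case comparable_factorizations_iff defs using that c d
      by (intro conjI disjI2 bexI[of _ t]) simp_all
    moreover have "?e (u, v) \<in> comparable_factorizations V A a b"
      if "u \<in> carrier M" "v \<in> carrier M" "a = b" for u v
      unfolding comparable_factorizations_iff defs using that by simp
    ultimately show "?R \<subseteq> comparable_factorizations V A a b"
      using Y(3) by (fastforce split: if_splits)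
  qed
  then show ?thesis using closedin_Un[OF closedin_Un[OF e f] g] by simp
qed

theorem theorem4p9:
  fixes V :: "nat semigrp set" and A :: "'a set"
    and x :: "'a pro_elt" and u v w z :: "'a pro_elt option" and a b :: 'a
  assumes "pseudovariety V"
    and "closed_bideterministic V"
    and "finite A"
    and "x \<in> carrier (free_pro V A)"
    and "good_factorization V A x (u, a, v)"
    and "w \<in> carrier (free_pro1 V A)" and "b \<in> A" and "z \<in> carrier (free_pro1 V A)"
    and "Some x = w \<otimes>\<^bsub>free_pro1 V A\<^esub> letter V A b \<otimes>\<^bsub>free_pro1 V A\<^esub> z"
  shows "(u = w \<and> a = b \<and> v = z) \<or>
    (\<exists>t\<in>carrier (free_pro1 V A).
       u = w \<otimes>\<^bsub>free_pro1 V A\<^esub> letter V A b \<otimes>\<^bsub>free_pro1 V A\<^esub> t \<and>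
       z = t \<otimes>\<^bsub>free_pro1 V A\<^esub> letter V A a \<otimes>\<^bsub>free_pro1 V A\<^esub> v) \<or>
    (\<exists>t\<in>carrier (free_pro1 V A).
       w = u \<otimes>\<^bsub>free_pro1 V A\<^esub> letter V A a \<otimes>\<^bsub>free_pro1 V A\<^esub> t \<and>
       v = t \<otimes>\<^bsub>free_pro1 V A\<^esub> letter V A b \<otimes>\<^bsub>free_pro1 V A\<^esub> z)"
proof -
  let ?M = "free_pro1 V A" and ?Y = "free_pro1_topology V A" and ?w = "pro_word1 V A"
  let ?c = "letter V A a" and ?d = "letter V A b"
  let ?Y2 = "prod_topology ?Y ?Y"
  let ?Y4 = "prod_topology ?Y2 ?Y2"
  have uv: "u \<in> carrier ?M" "a \<in> A" "v \<in> carrier ?M"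
    using assms(5) by (simp_all add: good_factorization_def)
  have d: "?d \<in> carrier ?M"
    using assms(7) by (simp add: letter_eq_pro_word1 pro_word1_closed)
  let ?E = "comparable_factorizations V A a b"
  have "((u, v), (w, z)) \<in> ?E"
  proof (rule ccontr)
    assume "((u, v), (w, z)) \<notin> ?E"
    then have mem: "((u, v), (w, z)) \<in> topspace ?Y4 - ?E"
      using uv assms(6,8) by (simp add: topspace_free_pro1)
    have "openin ?Y4 (topspace ?Y4 - ?E)"
      using closedin_comparable_factorizations[OF assms(1) uv(2) assms(7)] by (rule openin_diff[OF openin_topspace])
    from this[unfolded openin_prod_topology_alt[of ?Y2 ?Y2], rule_format, OF mem]
    obtain P Q where PQ: "openin ?Y2 P" "openin ?Y2 Q" "(u, v) \<in> P" "(w, z) \<in> Q" "P \<times> Q \<subseteq> topspace ?Y4 - ?E"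
      by blast
    from PQ(1)[unfolded openin_prod_topology_alt, rule_format, OF PQ(3)]
    obtain U U' where U: "openin ?Y U" "openin ?Y U'" "u \<in> U" "v \<in> U'" "U \<times> U' \<subseteq> P" by blast
    obtain C where C: "openin ?Y C" "Some x \<in> C"
      "\<And>y. y \<in> lists A \<Longrightarrow> ?w y \<in> C \<Longrightarrow>
         \<exists>l\<in>lists A. \<exists>k\<in>lists A. ?w l \<in> U \<and> ?w k \<in> U' \<and> y = l @ [a] @ k"
      using marked_product_neighbourhood[OF assms(1,2,3,5) U(1,3) U(2,4)] by blast
    let ?f = "\<lambda>r. fst r \<otimes>\<^bsub>?M\<^esub> ?d \<otimes>\<^bsub>?M\<^esub> snd r"
    have f: "continuous_map ?Y2 ?Y ?f"
      using d by (intro continuous_map_free_pro1_mult[OF assms(1)] continuous_map_fst continuous_map_snd)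
        (simp add: topspace_free_pro1)
    \<comment> \<open>Pairs close to \<open>(w, z)\<close> have their product with \<open>b\<close> in \<open>C\<close>, because \<open>w b z = x\<close> is in \<open>C\<close>.\<close>
    have "openin ?Y2 (Q \<inter> {r \<in> topspace ?Y2. ?f r \<in> C})"
      using PQ(2) openin_continuous_map_preimage[OF f C(1)] by blast
    moreover have "(w, z) \<in> Q \<inter> {r \<in> topspace ?Y2. ?f r \<in> C}"
      using PQ(4) C(2) assms(6,8) unfolding assms(9) by (simp add: topspace_free_pro1)
    ultimately obtain W Z where W: "openin ?Y W" "openin ?Y Z" "w \<in> W" "z \<in> Z"
        "W \<times> Z \<subseteq> Q \<inter> {r \<in> topspace ?Y2. ?f r \<in> C}"
      unfolding openin_prod_topology_alt by meson
    obtain w' where w': "w' \<in> lists A" "?w w' \<in> W" using W(1,3) by (rule pro_word1_dense)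
    obtain z' where z': "z' \<in> lists A" "?w z' \<in> Z" using W(2,4) by (rule pro_word1_dense)
    have wz': "(?w w', ?w z') \<in> Q \<inter> {r \<in> topspace ?Y2. ?f r \<in> C}" using w' z' W(5) by blast
    then have "?w (w' @ [b] @ z') \<in> C"
      using pro_word1_marked_product[OF w'(1) z'(1) assms(7), of V] by simp
    moreover have "w' @ [b] @ z' \<in> lists A" using w' z' assms(7) by simp
    ultimately obtain l k where lk: "l \<in> lists A" "k \<in> lists A" "?w l \<in> U" "?w k \<in> U'"
        "w' @ [b] @ z' = l @ [a] @ k"
      using C(3) by blast
    \<comment> \<open>Equidivisibility of \<open>A\<^sup>*\<close>, carried over to \<open>M\<close>.\<close>
    have "((?w l, ?w k), (?w w', ?w z')) \<in> ?E"
    proof -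
      have carriers: "{?w l, ?w k, ?w w', ?w z'} \<subseteq> carrier ?M"
        using lk(1,2) w'(1) z'(1) by (simp only: insert_subset empty_subsetI pro_word1_closed simp_thms)
      have "l @ [a] @ k \<in> lists A" using lk uv(2) by simp
      from free_monoid_equidivisible[OF lk(5)[symmetric] this]
      consider "l = w'" "a = b" "k = z'"
        | t where "t \<in> lists A" "l = w' @ [b] @ t" "z' = t @ [a] @ k"
        | t where "t \<in> lists A" "w' = l @ [a] @ t" "k = t @ [b] @ z'"
        by blast
      then show ?thesis
      proof cases
        case 1
        then show ?thesis
          using carriers unfolding comparable_factorizations_iff by blast
      next
        case 2
        have "?w l = ?w w' \<otimes>\<^bsub>?M\<^esub> ?d \<otimes>\<^bsub>?M\<^esub> ?w t" "?w z' = ?w t \<otimes>\<^bsub>?M\<^esub> ?c \<otimes>\<^bsub>?M\<^esub> ?w k"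
          unfolding 2(2,3) using 2(1) w'(1) lk(2) uv(2) assms(7) by (intro pro_word1_marked_product; simp)+
        then show ?thesis
          using pro_word1_closed[OF 2(1), of V] carriers unfolding comparable_factorizations_iff by blast
      next
        case 3
        have "?w w' = ?w l \<otimes>\<^bsub>?M\<^esub> ?c \<otimes>\<^bsub>?M\<^esub> ?w t" "?w k = ?w t \<otimes>\<^bsub>?M\<^esub> ?d \<otimes>\<^bsub>?M\<^esub> ?w z'"
          unfolding 3(2,3) using 3(1) z'(1) lk(1) uv(2) assms(7) by (intro pro_word1_marked_product; simp)+
        then show ?thesis
          using pro_word1_closed[OF 3(1), of V] carriers unfolding comparable_factorizations_iff by blast
      qed
    qed
    moreover have "((?w l, ?w k), (?w w', ?w z')) \<in> P \<times> Q" using lk U(5) wz' by blast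
    ultimately show False using PQ(5) by blast
  qed
  then show ?thesis unfolding comparable_factorizations_iff by blast
qed

end
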